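(* Let $\mathcal M\subset\mathbb R^d$ be a smooth compact submanifold with reach $\tau$, let $\varepsilon<\tau$, let $I_{\mathbb R^d}\colon C(\Omega,\mathbb R^d)\to C(\Omega,\mathbb R^d)$ be an approximation operator, and let $f\in C^1(\Omega,\mathcal M)$ be such that $\tilde f=I_{\mathbb R^d}f$ is differentiable and satisfies for all $\mathbf x\in\Omega$ $$\|f(\mathbf x)-\tilde f(\mathbf x)\|_2\le\varepsilon$$ (consequently $\tilde f$ takes values in the $\varepsilon$-tubular neighborhood of $\mathcal M$). Let $I_{\mathcal M}f=P_{\mathcal M}\circ\tilde f$. Then for all $\mathbf x\in\Omega$ $$\|\mathrm d I_{\mathcal M}f(\mathbf x)-\mathrm df(\mathbf x)\|_2\le\|\mathrm d\tilde f(\mathbf x)-\mathrm df(\mathbf x)\|_2+C\,\|f(\mathbf x)-\tilde f(\mathbf x)\|_2,$$ where $$C=\left(\frac2\tau+\frac1{\tau-\varepsilon}\right)\left(\|\mathrm d\tilde f(\mathbf x)-\mathrm df(\mathbf x)\|_2+\|\mathrm df(\mathbf x)\|_2\right).$$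
   Context: The reach $\tau>0$ of a smooth compact submanifold $\mathcal M\subset\mathbb R^d$ is the maximal constant such that $E(\mathbf m,\mathbf v)=\mathbf m+\mathbf v$ is injective on $\{(\mathbf m,\mathbf v):\mathbf m\in\mathcal M,\ \mathbf v\in N_{\mathbf m}\mathcal M,\ \|\mathbf v\|_2<\tau\}$, where $N_{\mathbf m}\mathcal M$ is the normal space at $\mathbf m$. On $U=\{\mathbf y\in\mathbb R^d:\min_{\mathbf m\in\mathcal M}\|\mathbf y-\mathbf m\|_2<\tau\}$ the projection operator $P_{\mathcal M}(\mathbf x)=\operatorname{argmin}_{\mathbf m\in\mathcal M}\|\mathbf x-\mathbf m\|_2$ is well defined and smooth. $\Omega$ is an arbitrary domain on which differentiability makes sense (an open subset of a Euclidean space, or a Riemannian manifold such as a torus or a sphere). An approximation operator is any map $C(\Omega,\mathbb R^d)\to C(\Omega,\mathbb R^d)$, and $f$ is regarded as an $\mathbb R^d$-valued function through $\mathcal M\subset\mathbb R^d$. $\mathrm d g(\mathbf x)$ denotes the differential of $g$ at $\mathbf x$; $\|\cdot\|_2$ is the Euclidean norm for vectors and the spectral (operator) norm for linear maps. *)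

theory Defs
  imports "HOL-Analysis.Analysis"
begin

section \<open>Functions of class \<open>C\<^sup>k\<close> and \<open>C\<^sup>\<infinity>\<close> on open sets\<close>

text \<open>
  In finite dimension, \<open>f\<close> is of class \<open>C\<^sup>k\<^sup>+\<^sup>1\<close> iff it is differentiable and all its
  directional derivatives are of class \<open>C\<^sup>k\<close>. Only meant for open \<open>S\<close>.
\<close>

primrec Ck_on :: "nat \<Rightarrow> 'a::euclidean_space set \<Rightarrow> ('a \<Rightarrow> 'b::real_normed_vector) \<Rightarrow> bool" where
  "Ck_on 0 S f \<longleftrightarrow> continuous_on S f"
| "Ck_on (Suc k) S f \<longleftrightarrow>
     (\<exists>f'. (\<forall>x\<in>S. (f has_derivative f' x) (at x)) \<and> (\<forall>v. Ck_on k S (\<lambda>x. f' x v)))"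

definition smooth_on :: "'a::euclidean_space set \<Rightarrow> ('a \<Rightarrow> 'b::real_normed_vector) \<Rightarrow> bool" where
  "smooth_on S f \<longleftrightarrow> (\<forall>k. Ck_on k S f)"


section \<open>Embedded submanifolds of Euclidean space and their reach\<close>

text \<open>
  Locally, \<open>M\<close> is straightened to a \<open>k\<close>-dimensional linear subspace by a diffeomorphism \<open>h\<close> of the
  ambient space (slice charts). There is no boundary; \<open>k = 0\<close> is allowed.
\<close>

definition smooth_submanifold :: "nat \<Rightarrow> 'b::euclidean_space set \<Rightarrow> bool" where
  "smooth_submanifold k M \<longleftrightarrow>
     (\<forall>p\<in>M. \<exists>U (V :: 'b set) h g S. open U \<and> p \<in> U \<and> open V \<and> homeomorphism U V h g \<and>
        smooth_on U h \<and> smooth_on V g \<and>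
        subspace S \<and> dim S = k \<and> h ` (M \<inter> U) = V \<inter> S)"

definition tangent_space :: "'b::euclidean_space set \<Rightarrow> 'b \<Rightarrow> 'b set" where
  "tangent_space M p =
     {v. \<exists>\<gamma> e. 0 < e \<and> smooth_on {-e<..<e} \<gamma> \<and> \<gamma> ` {-e<..<e} \<subseteq> M \<and> \<gamma> 0 = p \<and>
           (\<gamma> has_vector_derivative v) (at (0::real))}"

definition normal_space :: "'b::euclidean_space set \<Rightarrow> 'b \<Rightarrow> 'b set" where
  "normal_space M p = (tangent_space M p)\<^sup>\<bottom>"

text \<open>
  If the supremum is finite it is attained, because the norm bound below is strict; so it is the
  maximal \<open>\<tau>\<close> with the injectivity property. The value is \<open>\<infinity>\<close> if \<open>M\<close> is a single
  point, where \<open>E(m,v) = m + v\<close> is injective for every \<open>\<tau>\<close>.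
\<close>

definition reach :: "'b::euclidean_space set \<Rightarrow> ereal" where
  "reach M = Sup {ereal \<tau> |\<tau>. 0 < \<tau> \<and>
     inj_on (\<lambda>(m, v). m + v) {(m, v). m \<in> M \<and> v \<in> normal_space M m \<and> norm v < \<tau>}}"


section \<open>Riemannian manifolds\<close>

text \<open>
  A chart is a pair of its domain and its coordinate map. The second component is irrelevant outside
  the first.
\<close>

type_synonym ('p, 'e) chart = "'p set \<times> ('p \<Rightarrow> 'e)"

definition in_coords :: "('p, 'e) chart \<Rightarrow> ('p \<Rightarrow> 'b) \<Rightarrow> 'e \<Rightarrow> 'b" where
  "in_coords c f = f \<circ> inv_into (fst c) (snd c)"

definition smooth_atlas :: "'p topology \<Rightarrow> ('p, 'e::euclidean_space) chart set \<Rightarrow> bool" where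
  "smooth_atlas X A \<longleftrightarrow>
     (\<Union>(fst ` A)) = topspace X \<and>
     (\<forall>(U, \<phi>)\<in>A. openin X U \<and> open (\<phi> ` U) \<and>
        homeomorphic_map (subtopology X U) (top_of_set (\<phi> ` U)) \<phi>) \<and>
     (\<forall>(U, \<phi>)\<in>A. \<forall>(V, \<psi>)\<in>A. smooth_on (\<phi> ` (U \<inter> V)) (in_coords (U, \<phi>) \<psi>))"

definition chart_deriv ::
  "('p, 'e::euclidean_space) chart \<Rightarrow> ('p \<Rightarrow> 'b::real_normed_vector) \<Rightarrow> 'p \<Rightarrow> 'e \<Rightarrow> 'b" where
  "chart_deriv c f x = frechet_derivative (in_coords c f) (at (snd c x))"

text \<open>
  \<open>G c x\<close> is the inner product on the tangent space at \<open>x\<close>, expressed in the coordinates of the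
  chart \<open>c\<close>; the last condition is the transformation rule under change of charts.
\<close>

definition riemannian_metric ::
  "('p, 'e::euclidean_space) chart set \<Rightarrow> (('p, 'e) chart \<Rightarrow> 'p \<Rightarrow> 'e \<Rightarrow> 'e \<Rightarrow> real) \<Rightarrow> bool" where
  "riemannian_metric A G \<longleftrightarrow>
     (\<forall>c\<in>A. \<forall>x\<in>fst c. bilinear (G c x) \<and> (\<forall>v w. G c x v w = G c x w v) \<and>
        (\<forall>v. v \<noteq> 0 \<longrightarrow> 0 < G c x v v)) \<and>
     (\<forall>c\<in>A. \<forall>v w. smooth_on (snd c ` fst c) (in_coords c (\<lambda>x. G c x v w))) \<and>
     (\<forall>c\<in>A. \<forall>c'\<in>A. \<forall>x \<in> fst c \<inter> fst c'. \<forall>v w.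
        G c x v w = G c' x (chart_deriv c (snd c') x v) (chart_deriv c (snd c') x w))"

definition riemannian_manifold ::
  "'p topology \<Rightarrow> ('p, 'e::euclidean_space) chart set \<Rightarrow>
     (('p, 'e) chart \<Rightarrow> 'p \<Rightarrow> 'e \<Rightarrow> 'e \<Rightarrow> real) \<Rightarrow> bool" where
  "riemannian_manifold X A G \<longleftrightarrow>
     Hausdorff_space X \<and> second_countable X \<and> smooth_atlas X A \<and> riemannian_metric A G"

definition differentiable_in ::
  "('p, 'e::euclidean_space) chart set \<Rightarrow> ('p \<Rightarrow> 'b::real_normed_vector) \<Rightarrow> 'p \<Rightarrow> bool" where
  "differentiable_in A f x \<longleftrightarrow>
     (\<forall>c\<in>A. x \<in> fst c \<longrightarrow> in_coords c f differentiable (at (snd c x)))"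

definition C1_in ::
  "('p, 'e::euclidean_space) chart set \<Rightarrow> ('p \<Rightarrow> 'b::real_normed_vector) \<Rightarrow> bool" where
  "C1_in A f \<longleftrightarrow> (\<forall>c\<in>A. Ck_on 1 (snd c ` fst c) (in_coords c f))"

text \<open>
  The spectral norm of a linear map whose domain carries the inner product \<open>q\<close>. With
  \<open>q = G c x\<close> it does not depend on the chart \<open>c\<close> around \<open>x\<close>, by the transformation rule.
\<close>

definition spectral_norm ::
  "('e \<Rightarrow> 'e \<Rightarrow> real) \<Rightarrow> ('e::euclidean_space \<Rightarrow> 'b::real_normed_vector) \<Rightarrow> real" where
  "spectral_norm q L = (SUP v. norm (L v) / sqrt (q v v))"


section \<open>Open subsets of Euclidean space as Riemannian manifolds\<close>

lemma Ck_on_const: "Ck_on k S (\<lambda>x. c)"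
proof (induction k arbitrary: c)
  case (Suc k)
  show ?case
    unfolding Ck_on.simps by (rule exI[of _ "\<lambda>x v. 0"]) (use Suc in auto)
qed auto

lemma Ck_on_ident_on:
  assumes "open S" "\<And>x. x \<in> S \<Longrightarrow> f x = x"
  shows "Ck_on k S f"
proof (cases k)
  case 0
  then show ?thesis using assms by (auto cong: continuous_on_cong)
next
  case (Suc n)
  have "(f has_derivative (\<lambda>v. v)) (at x)" if "x \<in> S" for x
    by (rule has_derivative_transform_within_open[OF has_derivative_ident assms(1) that])
      (simp add: assms(2))
  then show ?thesis
    unfolding Suc Ck_on.simps by (intro exI[of _ "\<lambda>x v. v"]) (auto simp: Ck_on_const)
qed

lemma spectral_norm_inner: "spectral_norm (\<bullet>) L = onorm L"
  unfolding spectral_norm_def onorm_def by (simp flip: norm_eq_sqrt_inner)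

lemma riemannian_manifold_open_set:
  fixes W :: "'e::euclidean_space set"
  assumes "open W"
  shows "riemannian_manifold (top_of_set W) {(W, \<lambda>x. x)} (\<lambda>c x. (\<bullet>))"
proof -
  have inv: "inv_into W (\<lambda>x. x) x = x" if "x \<in> W" for x
    using that by (intro inv_into_f_f[where f="\<lambda>x. x", simplified]) auto
  have sm: "smooth_on W (in_coords (W, \<lambda>x. x) (\<lambda>x. x))"
    unfolding smooth_on_def by (intro allI Ck_on_ident_on[OF assms]) (simp add: in_coords_def inv)
  have der: "chart_deriv (W, \<lambda>x. x) (\<lambda>x. x) x = (\<lambda>v. v)" if "x \<in> W" for x
  proof -
    have "(in_coords (W, \<lambda>x. x) (\<lambda>x. x) has_derivative (\<lambda>v. v)) (at x)"
      by (rule has_derivative_transform_within_open[OF has_derivative_ident assms that])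
        (simp add: in_coords_def inv)
    from frechet_derivative_at[OF this] show ?thesis
      by (simp add: chart_deriv_def)
  qed
  have metric: "smooth_on W (in_coords (W, \<lambda>x. x) (\<lambda>x. v \<bullet> w))" for v w :: 'e
    by (simp add: smooth_on_def in_coords_def comp_def Ck_on_const)
  have "second_countable (top_of_set W)"
  proof -
    obtain B :: "'e set set" where B: "countable B" "topological_basis B"
      using ex_countable_basis by (elim exE conjE)
    have "\<exists>V\<in>B. x \<in> V \<and> V \<subseteq> S" if "open S" "x \<in> S" for S x
      by (rule topological_basisE[OF B(2) that]) (rule bexI, rule conjI)
    with B have "second_countable (euclidean :: 'e topology)"
      unfolding second_countable_def
      by (intro exI[of _ B]) (simp add: topological_basis_open)
    then show ?thesis
      by (rule second_countable_subtopology)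
  qed
  moreover have "Hausdorff_space (top_of_set W)"
    by (simp add: Hausdorff_space_subtopology)
  moreover have "smooth_atlas (top_of_set W) {(W, \<lambda>x. x)}"
    using assms sm homeomorphic_map_id[of "top_of_set W" "top_of_set W"]
    by (simp add: smooth_atlas_def id_def subtopology_subtopology)
  moreover have "riemannian_metric {(W, \<lambda>x. x)} (\<lambda>c x. (\<bullet>))"
    unfolding riemannian_metric_def
  proof (intro conjI ballI allI impI; elim singletonE; (simp only: fst_conv snd_conv image_ident)?)
    show "bilinear ((\<bullet>) :: 'e \<Rightarrow> 'e \<Rightarrow> real)"
      by (simp add: bilinear_conv_bounded_bilinear bounded_bilinear_inner)
  qed (simp_all add: metric der inner_commute)
  ultimately show ?thesis
    by (simp add: riemannian_manifold_def)
qed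

end

theory Submission
  imports Defs
begin

text \<open>
  Let \<open>P\<close> be the projection onto \<open>M\<close> and \<open>D y\<close> its derivative at a point \<open>y\<close> of the tube of radius \<open>\<tau>\<close>. If
  \<open>m \<in> M\<close>, then \<open>D m\<close> is the orthogonal projection onto the tangent space. Since \<open>P \<circ> f = f\<close>, the chain rule
  gives \<open>d(P \<circ> ft) - df = (D (ft x) - D (f x)) dft + D (f x) (dft - df)\<close>, so it suffices to estimate
  \<open>D y - D m\<close> for \<open>y = ft x\<close> and \<open>m = f x\<close>, at distance \<open>r\<close>.

  Balls of radius \<open>\<tau>\<close> tangent to \<open>M\<close> do not meet \<open>M\<close>. This makes \<open>w - D y w\<close> small against \<open>D y w\<close> in the
  quadratic form sense, and symmetry of \<open>D y\<close> (it is the Hessian of a function) turns this into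
  \<open>norm (D y - D (P y)) \<le> d / (\<tau> - d)\<close>, where \<open>d\<close> is the distance of \<open>y\<close> from \<open>M\<close>. On \<open>M\<close> the map \<open>D\<close> has local
  Lipschitz constant \<open>1 / \<tau>\<close>; integration along the projected segment gives
  \<open>norm (D p - D q) \<le> 2 * norm (p - q) / \<tau>\<close>. The lost factor is regained because \<open>P y\<close> cannot be far from both
  \<open>y\<close> and \<open>m\<close>.
\<close>

section \<open>Projection onto a set of positive reach\<close>

text \<open>Behind the estimates stands the shape operator \<open>S\<close> in the normal direction
  \<open>v\<close>, with \<open>norm S \<le> norm v / \<tau>\<close>. On the tangent space at the
  foot point \<open>q\<close>, \<open>D (q + v)\<close> is the inverse of \<open>1 - S\<close>.
  Hence \<open>D y - D (P y)\<close> acts there as \<open>S\<close> times that inverse, which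
  explains \<open>d / (\<tau> - d)\<close>. Once \<open>P\<close> is known to be differentiable,
  \<open>S\<close> is never formed: its bound is carried by inequalities for \<open>D y\<close>, and
  \<open>D m\<close> stands in for the tangent space, which by definition is only a set of
  velocities.

  The constant arises as follows. Let \<open>a\<close> be the distance from \<open>m\<close> to
  \<open>P y\<close>. Comparison along \<open>M\<close> costs \<open>2 * a / \<tau>\<close>. For
  \<open>2 * r < \<tau>\<close> the tangent ball at \<open>P y\<close> yields
  \<open>2 * a \<le> 3 * r - d\<close>, so the excess over \<open>2 * r / \<tau>\<close> is at most
  \<open>(r - d) / \<tau>\<close>, and this fits into the gap between
  \<open>d / (\<tau> - d)\<close> and \<open>r / (\<tau> - r)\<close>. For
  \<open>2 * r \<ge> \<tau>\<close> the term \<open>2 * r / \<tau>\<close> already dominates 1, the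
  trivial bound for a difference of two orthogonal projections.\<close>

lemma minimizer_orthogonal:
  fixes \<gamma> :: "real \<Rightarrow> 'b::real_inner"
  assumes "(\<gamma> has_vector_derivative w) (at 0)"
    and "\<forall>\<^sub>F t in at 0. dist y (\<gamma> 0) \<le> dist y (\<gamma> t)"
  shows "(y - \<gamma> 0) \<bullet> w = 0"
proof -
  \<comment> \<open>The squared distance is used because the distance itself need not be
    differentiable where \<open>y = \<gamma> 0\<close>.\<close>
  let ?f = "\<lambda>t. (y - \<gamma> t) \<bullet> (y - \<gamma> t)"
  have "(?f has_derivative (\<lambda>t. (y - \<gamma> 0) \<bullet> (0 - t *\<^sub>R w) + (0 - t *\<^sub>R w) \<bullet> (y - \<gamma> 0))) (at 0)"
    using assms(1) unfolding has_vector_derivative_def by (intro derivative_intros)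
  moreover have "(\<lambda>t. (y - \<gamma> 0) \<bullet> (0 - t *\<^sub>R w) + (0 - t *\<^sub>R w) \<bullet> (y - \<gamma> 0)) = (*) (- 2 * ((y - \<gamma> 0) \<bullet> w))"
    by (auto simp: inner_commute algebra_simps)
  ultimately have der: "DERIV ?f 0 :> - 2 * ((y - \<gamma> 0) \<bullet> w)"
    by (simp add: has_field_derivative_def)
  obtain d where d: "d > 0" "\<And>t. t \<noteq> 0 \<Longrightarrow> dist t 0 < d \<Longrightarrow> dist y (\<gamma> 0) \<le> dist y (\<gamma> t)"
    using assms(2) unfolding eventually_at by auto
  have "?f 0 \<le> ?f t" if "\<bar>0 - t\<bar> < d" for t
  proof (cases "t = 0")
    case False
    then have "norm (y - \<gamma> 0) \<le> norm (y - \<gamma> t)" using d(2)[of t] that by (simp add: dist_norm)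
    then show ?thesis by (simp add: norm_le)
  qed auto
  then show ?thesis using DERIV_local_min[OF der d(1)] by auto
qed

text \<open>Here \<tau> is any radius with the injectivity property, not the supremum
  \<open>reach M\<close>; the theorem instantiates it with the radii strictly between \<epsilon> and
  the reach.\<close>

locale positive_reach =
  fixes M :: "'b::euclidean_space set" and \<tau> :: real
  assumes compact: "compact M" and nonempty: "M \<noteq> {}" and \<tau>_pos: "0 < \<tau>"
    and inj: "inj_on (\<lambda>(m, v). m + v) {(m, v). m \<in> M \<and> v \<in> normal_space M m \<and> norm v < \<tau>}"
begin

abbreviation P :: "'b \<Rightarrow> 'b" where "P \<equiv> closest_point M"

definition height :: "'b \<Rightarrow> real" where "height y = norm (y - P y)"

definition tube :: "'b set" where "tube = {y. height y < \<tau>}"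

lemma closed: "closed M" using compact by (rule compact_imp_closed)

lemma P_in: "P y \<in> M" by (rule closest_point_in_set[OF closed nonempty])

lemma P_le: "q \<in> M \<Longrightarrow> norm (y - P y) \<le> norm (y - q)"
  using closest_point_le[OF closed] by (simp add: dist_norm)

lemma P_self: "m \<in> M \<Longrightarrow> P m = m" by (rule closest_point_self)

lemma height_nonneg: "0 \<le> height y" by (simp add: height_def)

lemma height_le: "q \<in> M \<Longrightarrow> height y \<le> norm (y - q)"
  unfolding height_def by (rule P_le)

lemma tubeI: "q \<in> M \<Longrightarrow> norm (y - q) < \<tau> \<Longrightarrow> y \<in> tube"
  using height_le[of q y] by (simp add: tube_def)

lemma M_tube: "m \<in> M \<Longrightarrow> m \<in> tube" using tubeI[of m m] \<tau>_pos by simp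

lemma height_infdist: "height y = infdist y M"
proof (rule antisym)
  show "height y \<le> infdist y M"
    unfolding infdist_def using nonempty height_le
    by (auto simp: dist_norm intro!: cINF_greatest)
  show "infdist y M \<le> height y"
    unfolding height_def using infdist_le[OF P_in] by (simp add: dist_norm)
qed

lemma open_tube: "open tube"
proof -
  have "tube = (\<lambda>y. infdist y M) -` {..<\<tau>}" by (auto simp: tube_def height_infdist)
  also have "open \<dots>" by (intro open_vimage continuous_intros open_lessThan)
  finally show ?thesis .
qed

section \<open>Foot points, normal vectors and tangent balls\<close>

lemma minimizer_normal:
  assumes "m \<in> M" "\<And>q. q \<in> M \<Longrightarrow> norm (y - m) \<le> norm (y - q)"
  shows "y - m \<in> normal_space M m"
  unfolding normal_space_def orthogonal_comp_def orthogonal_def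
proof safe
  fix w assume "w \<in> tangent_space M m"
  then obtain \<gamma> e where *: "0 < e" "\<gamma> ` {-e<..<e} \<subseteq> M" "\<gamma> 0 = m"
    "(\<gamma> has_vector_derivative w) (at (0::real))"
    unfolding tangent_space_def by blast
  have "\<forall>\<^sub>F t in at 0. dist y (\<gamma> 0) \<le> dist y (\<gamma> t)"
    unfolding eventually_at using * assms(2)
    by (intro exI[of _ e]) (auto simp: dist_norm image_subset_iff abs_less_iff)
  from minimizer_orthogonal[OF *(4) this] show "w \<bullet> (y - m) = 0" using *(3) by (simp add: inner_commute)
qed

lemma P_normal: "y - P y \<in> normal_space M (P y)"
  by (rule minimizer_normal[OF P_in P_le])

text \<open>With \<open>y = m + v\<close>, both \<open>(m, v)\<close> and
  \<open>(P y, y - P y)\<close> decompose \<open>y\<close> into a point of \<open>M\<close> and a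
  short normal vector, so injectivity identifies them. The injectivity hypothesis acts only through
  this lemma; all curvature bounds descend from it.\<close>

lemma P_add_normal:
  assumes "m \<in> M" "v \<in> normal_space M m" "norm v < \<tau>"
  shows "P (m + v) = m"
proof -
  let ?y = "m + v"
  have "norm (?y - P ?y) < \<tau>" using P_le[OF assms(1), of ?y] assms(3) by simp
  then have "(P ?y, ?y - P ?y) = (m, v)"
    using assms P_in[of ?y] P_normal[of ?y] by (intro inj_onD[OF inj]) auto
  then show ?thesis by simp
qed

lemma height_add_normal:
  assumes "m \<in> M" "v \<in> normal_space M m" "norm v < \<tau>"
  shows "height (m + v) = norm v"
  by (simp add: height_def P_add_normal[OF assms])

lemma subspace_normal: "subspace (normal_space M m)"
  unfolding normal_space_def by (rule subspace_orthogonal_comp)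

text \<open>The open balls of radius \<open>\<tau>\<close> tangent to \<open>M\<close> at \<open>m\<close> do not meet \<open>M\<close>.\<close>

lemma inner_normal_le:
  assumes "m \<in> M" "q \<in> M" "v \<in> normal_space M m"
  shows "2 * \<tau> * \<bar>(q - m) \<bullet> v\<bar> \<le> norm (q - m) ^ 2 * norm v"
proof -
  have main: "2 * \<tau> * ((q - m) \<bullet> v) \<le> norm (q - m) ^ 2 * norm v" if v: "v \<in> normal_space M m" for v
  proof (cases "v = 0")
    case False
    define u where "u = v /\<^sub>R norm v"
    have u: "u \<in> normal_space M m" "norm u = 1"
      using False v subspace_normal by (auto simp: u_def subspace_mul)
    have vu: "v = norm v *\<^sub>R u" using False by (simp add: u_def)
    have *: "2 * t * ((q - m) \<bullet> u) \<le> norm (q - m) ^ 2" if "0 < t" "t < \<tau>" for t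
    proof -
      have tu: "t *\<^sub>R u \<in> normal_space M m" "norm (t *\<^sub>R u) < \<tau>"
        using u that subspace_normal by (auto simp: subspace_mul)
      have "norm (m + t *\<^sub>R u - m) \<le> norm (m + t *\<^sub>R u - q)"
        using P_le[OF assms(2), of "m + t *\<^sub>R u"] P_add_normal[OF assms(1) tu] by simp
      then have "norm (t *\<^sub>R u) ^ 2 \<le> norm (t *\<^sub>R u - (q - m)) ^ 2"
        by (intro power_mono) (auto simp: algebra_simps)
      also have "\<dots> = norm (t *\<^sub>R u) ^ 2 - 2 * t * ((q - m) \<bullet> u) + norm (q - m) ^ 2"
        by (simp only: power2_norm_eq_inner inner_diff_left inner_diff_right)
          (simp add: inner_commute algebra_simps)
      finally show ?thesis by simp
    qed
    \<comment> \<open>\<open>P_add_normal\<close> needs a norm strictly below \<tau>, so the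
      constant \<tau> is reached only in the limit from the left.\<close>
    have "2 * \<tau> * ((q - m) \<bullet> u) \<le> norm (q - m) ^ 2"
    proof (rule tendsto_upperbound)
      show "((\<lambda>t. 2 * t * ((q - m) \<bullet> u)) \<longlongrightarrow> 2 * \<tau> * ((q - m) \<bullet> u)) (at_left \<tau>)"
        by (intro tendsto_intros)
      show "\<forall>\<^sub>F t in at_left \<tau>. 2 * t * ((q - m) \<bullet> u) \<le> norm (q - m) ^ 2"
        unfolding eventually_at_left_field using * \<tau>_pos by blast
    qed simp
    then have "norm v * (2 * \<tau> * ((q - m) \<bullet> u)) \<le> norm v * norm (q - m) ^ 2"
      by (rule mult_left_mono) simp
    then show ?thesis by (subst (1) vu) (simp add: algebra_simps)
  qed auto
  have "- v \<in> normal_space M m" using assms(3) subspace_normal subspace_neg by blast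
  from main[OF this] main[OF assms(3)] \<tau>_pos show ?thesis
    by (auto simp: abs_if algebra_simps)
qed

text \<open>The vector \<open>x - y\<close> is \<open>P x - P y\<close> plus the difference of the
  normal vectors \<open>x - P x\<close> and \<open>y - P y\<close>. What remains are the products of
  the chord with these two, and a tangent ball bounds each. This is the finite-difference form of
  the curvature bound.\<close>

lemma inner_P_diff:
  shows "\<bar>(P x - P y) \<bullet> (x - y) - norm (P x - P y) ^ 2\<bar>
    \<le> (height x + height y) / (2 * \<tau>) * norm (P x - P y) ^ 2"
proof -
  have 1: "2 * \<tau> * \<bar>(P x - P y) \<bullet> (y - P y)\<bar> \<le> norm (P x - P y) ^ 2 * height y"
    unfolding height_def by (rule inner_normal_le[OF P_in P_in P_normal])
  have 2: "2 * \<tau> * \<bar>(P y - P x) \<bullet> (x - P x)\<bar> \<le> norm (P x - P y) ^ 2 * height x"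
    using inner_normal_le[OF P_in P_in P_normal, of y x] by (simp add: norm_minus_commute height_def)
  have "(P x - P y) \<bullet> (x - y) - norm (P x - P y) ^ 2
      = - ((P y - P x) \<bullet> (x - P x)) - (P x - P y) \<bullet> (y - P y)"
    by (simp add: power2_norm_eq_inner inner_diff algebra_simps inner_commute)
  then have "2 * \<tau> * \<bar>(P x - P y) \<bullet> (x - y) - norm (P x - P y) ^ 2\<bar>
      \<le> 2 * \<tau> * (\<bar>(P y - P x) \<bullet> (x - P x)\<bar> + \<bar>(P x - P y) \<bullet> (y - P y)\<bar>)"
    using \<tau>_pos by (intro mult_left_mono) auto
  also have "\<dots> \<le> (height x + height y) * norm (P x - P y) ^ 2"
    using 1 2 by (simp add: algebra_simps)
  finally show ?thesis using \<tau>_pos by (simp add: field_simps)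
qed

text \<open>Cauchy-Schwarz applied to one half of \<open>inner_P_diff\<close>. Since the mean of the
  two heights enters, heights of at most \<open>\<tau> / 2\<close> give the Lipschitz constant 2
  that is used along segments.\<close>

lemma P_lipschitz_strong:
  "(1 - (height x + height y) / (2 * \<tau>)) * norm (P x - P y) \<le> norm (x - y)"
proof (cases "P x = P y")
  case False
  have "(1 - (height x + height y) / (2 * \<tau>)) * norm (P x - P y) ^ 2 \<le> (P x - P y) \<bullet> (x - y)"
    using inner_P_diff[of x y] by (auto simp: algebra_simps abs_le_iff)
  also have "\<dots> \<le> norm (P x - P y) * norm (x - y)" by (rule norm_cauchy_schwarz)
  finally have "norm (P x - P y) * ((1 - (height x + height y) / (2 * \<tau>)) * norm (P x - P y))
      \<le> norm (P x - P y) * norm (x - y)"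
    by (simp only: power2_eq_square mult_ac)
  then show ?thesis using False by (simp only: mult_le_cancel_left) auto
qed simp

lemma height_lipschitz: "height x \<le> height y + norm (x - y)"
proof -
  have "height x \<le> norm (x - P y)" by (rule height_le[OF P_in])
  also have "\<dots> = norm ((y - P y) + (x - y))" by (simp add: algebra_simps)
  also have "\<dots> \<le> height y + norm (x - y)"
    unfolding height_def by (rule norm_triangle_ineq)
  finally show ?thesis .
qed

lemma P_locally_lipschitz:
  assumes "y \<in> tube"
  obtains C where "0 < C" "\<forall>\<^sub>F x in nhds y. norm (P x - P y) \<le> C * norm (x - y)"
proof
  \<comment> \<open>Within distance \<open>\<tau> - height y\<close> of \<open>y\<close> heights are
    at most \<tau>, so the factor in \<open>P_lipschitz_strong\<close> is at least
    \<open>1 - (\<tau> + height y) / (2 * \<tau>)\<close>, which is \<open>c\<close>.\<close>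
  define c where "c = (\<tau> - height y) / (2 * \<tau>)"
  have c: "c > 0" using assms \<tau>_pos by (simp add: c_def tube_def)
  show "0 < 1 / c" using c by simp
  show "\<forall>\<^sub>F x in nhds y. norm (P x - P y) \<le> 1 / c * norm (x - y)"
    unfolding eventually_nhds_metric
  proof (intro exI conjI allI impI)
    show "0 < \<tau> - height y" using assms by (simp add: tube_def)
    fix x assume "dist x y < \<tau> - height y"
    then have "height x \<le> \<tau>"
      using height_lipschitz[of x y] by (simp add: dist_norm)
    then have "c \<le> 1 - (height x + height y) / (2 * \<tau>)"
      using \<tau>_pos by (simp add: c_def field_simps)
    then have "c * norm (P x - P y) \<le> norm (x - y)"
      using P_lipschitz_strong[of x y] by (meson mult_right_mono norm_ge_zero order_trans)
    then show "norm (P x - P y) \<le> 1 / c * norm (x - y)"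
      using c by (simp add: field_simps)
  qed
qed

lemma P_isCont:
  assumes "y \<in> tube" shows "isCont P y"
proof -
  obtain C where C: "0 < C" "\<forall>\<^sub>F x in nhds y. norm (P x - P y) \<le> C * norm (x - y)"
    using P_locally_lipschitz[OF assms] .
  have "((\<lambda>x. P x - P y) \<longlongrightarrow> 0) (at y)"
  proof (rule Lim_null_comparison)
    show "\<forall>\<^sub>F x in at y. norm (P x - P y) \<le> C * norm (x - y)"
      using C(2) by (rule eventually_nhds_conv_at[THEN iffD1, THEN conjunct1])
    show "((\<lambda>x. C * norm (x - y)) \<longlongrightarrow> 0) (at y)"
      by (auto intro!: tendsto_eq_intros)
  qed
  then show ?thesis unfolding isCont_def by (rule LIM_zero_cancel)
qed

end

section \<open>Calculus in slice charts\<close>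

text \<open>The solution \<sigma> is already given and Lipschitz at \<open>y\<close>; only its
  derivative is sought. Expanding \<Phi> shows that
  \<open>\<Phi>' (z - y, \<sigma> z - \<sigma> y)\<close> is of smaller order than
  \<open>norm (z - y)\<close>, and the left inverse \<open>R\<close> of the partial derivative
  isolates \<open>\<sigma> z - \<sigma> y\<close>.\<close>

lemma implicit_function_derivative:
  fixes \<Phi> :: "'a::real_normed_vector \<times> 'b::real_normed_vector \<Rightarrow> 'c::real_normed_vector"
  assumes \<Phi>: "(\<Phi> has_derivative \<Phi>') (at (y, \<sigma> y))"
    and zero: "\<forall>\<^sub>F z in nhds y. \<Phi> (z, \<sigma> z) = 0"
    and lip: "\<forall>\<^sub>F z in nhds y. norm (\<sigma> z - \<sigma> y) \<le> K * norm (z - y)"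
    and R: "bounded_linear R" "\<And>\<delta>. R (\<Phi>' (0, \<delta>)) = \<delta>"
  shows "(\<sigma> has_derivative (\<lambda>w. - R (\<Phi>' (w, 0)))) (at y)"
proof -
  interpret \<Phi>': bounded_linear \<Phi>' using \<Phi> by (rule has_derivative_bounded_linear)
  interpret R: bounded_linear R by fact
  obtain B where B: "0 < B" "\<And>x. norm (R x) \<le> norm x * B" using R.pos_bounded by auto
  define L where "L = max K 0"
  have lip': "\<forall>\<^sub>F z in nhds y. norm (\<sigma> z - \<sigma> y) \<le> L * norm (z - y)"
    using lip
  proof eventually_elim
    case (elim z)
    have "K * norm (z - y) \<le> L * norm (z - y)" by (intro mult_right_mono) (auto simp: L_def)
    with elim show ?case by linarith
  qed
  have L: "L \<ge> 0" by (simp add: L_def)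
  have bl: "bounded_linear (\<lambda>w. - R (\<Phi>' (w, 0)))"
    by (intro bounded_linear_minus bounded_linear_compose[OF R(1)]
        bounded_linear_compose[OF \<Phi>'.bounded_linear_axioms]
        bounded_linear_Pair bounded_linear_ident bounded_linear_zero)
  have "\<exists>d>0. \<forall>z. norm (z - y) < d \<longrightarrow>
      norm (\<sigma> z - \<sigma> y - - R (\<Phi>' (z - y, 0))) \<le> e * norm (z - y)" if e: "e > 0" for e
  proof -
    \<comment> \<open>Applying \<open>R\<close> costs the factor \<open>B\<close>; passing from the
      pair to its first component costs \<open>1 + L\<close>.\<close>
    define e' where "e' = e / (B * (1 + L))"
    have e': "e' > 0" using e B L by (simp add: e'_def)
    obtain d where d: "d > 0" "\<And>p. norm (p - (y, \<sigma> y)) < d \<Longrightarrow>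
        norm (\<Phi> p - \<Phi> (y, \<sigma> y) - \<Phi>' (p - (y, \<sigma> y))) \<le> e' * norm (p - (y, \<sigma> y))"
      using \<Phi> e' unfolding has_derivative_at_alt by meson
    obtain d' where d': "d' > 0" "\<And>z. dist z y < d' \<Longrightarrow>
        \<Phi> (z, \<sigma> z) = 0 \<and> norm (\<sigma> z - \<sigma> y) \<le> L * norm (z - y)"
      using eventually_conj[OF zero lip'] unfolding eventually_nhds_metric by auto
    show ?thesis
    proof (intro exI conjI allI impI)
      show "min d' (d / (1 + L)) > 0" using d(1) d'(1) L by simp
      fix z assume "norm (z - y) < min d' (d / (1 + L))"
      then have zd: "norm (z - y) < d / (1 + L)" "dist z y < d'" by (auto simp: dist_norm)
      have lipz: "norm (\<sigma> z - \<sigma> y) \<le> L * norm (z - y)" using d'(2)[OF zd(2)] by simp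
      have z0: "\<Phi> (z, \<sigma> z) = 0" "\<Phi> (y, \<sigma> y) = 0" using d'(2)[OF zd(2)] d'(2)[of y] d'(1) by auto
      have "norm ((z, \<sigma> z) - (y, \<sigma> y)) \<le> norm (z - y) + norm (\<sigma> z - \<sigma> y)"
        by (simp add: norm_Pair sqrt_sum_squares_le_sum)
      also have "\<dots> \<le> (1 + L) * norm (z - y)" using lipz by (simp add: algebra_simps)
      finally have n: "norm ((z, \<sigma> z) - (y, \<sigma> y)) \<le> (1 + L) * norm (z - y)" .
      also have "\<dots> < d" using zd(1) L by (simp add: field_simps)
      finally have "norm (\<Phi>' (z - y, \<sigma> z - \<sigma> y)) \<le> e' * norm ((z, \<sigma> z) - (y, \<sigma> y))"
        using d(2)[of "(z, \<sigma> z)"] z0 by simp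
      also have "\<dots> \<le> e' * ((1 + L) * norm (z - y))" using n e' by (intro mult_left_mono) auto
      finally have le: "norm (\<Phi>' (z - y, \<sigma> z - \<sigma> y)) \<le> e' * ((1 + L) * norm (z - y))" .
      have "\<Phi>' (z - y, \<sigma> z - \<sigma> y) = \<Phi>' (z - y, 0) + \<Phi>' (0, \<sigma> z - \<sigma> y)"
        by (simp flip: \<Phi>'.add)
      then have "\<sigma> z - \<sigma> y - - R (\<Phi>' (z - y, 0)) = R (\<Phi>' (z - y, \<sigma> z - \<sigma> y))"
        by (simp add: R.add R(2))
      then have "norm (\<sigma> z - \<sigma> y - - R (\<Phi>' (z - y, 0))) \<le> norm (\<Phi>' (z - y, \<sigma> z - \<sigma> y)) * B"
        using B(2) by simp
      also have "\<dots> \<le> e' * ((1 + L) * norm (z - y)) * B"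
        using le B(1) by (intro mult_right_mono) auto
      also have "\<dots> = e' * (B * (1 + L)) * norm (z - y)" by (simp only: mult_ac)
      also have "e' * (B * (1 + L)) = e" using B(1) L by (simp add: e'_def)
      finally show "norm (\<sigma> z - \<sigma> y - - R (\<Phi>' (z - y, 0))) \<le> e * norm (z - y)" .
    qed
  qed
  with bl show ?thesis unfolding has_derivative_at_alt by blast
qed

text \<open>If \<open>c\<close> were positive, \<open>r'\<close> would be positive immediately to
  the right of 0, and \<open>r\<close> would exceed \<open>r 0\<close> there.\<close>

lemma local_max_second_derivative_le_0:
  fixes r :: "real \<Rightarrow> real"
  assumes r': "\<forall>\<^sub>F t in nhds 0. DERIV r t :> r' t"
    and "r' 0 = 0" "DERIV r' 0 :> c"
    and max: "\<forall>\<^sub>F t in nhds 0. r t \<le> r 0"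
  shows "c \<le> 0"
proof (rule ccontr)
  assume "\<not> c \<le> 0"
  then obtain d where d: "d > 0" "\<And>t. 0 < t \<Longrightarrow> t < d \<Longrightarrow> r' 0 < r' (0 + t)"
    using DERIV_pos_inc_right[OF assms(3)] by auto
  obtain d' where d': "d' > 0" "\<And>t. dist t 0 < d' \<Longrightarrow> DERIV r t :> r' t \<and> r t \<le> r 0"
    using eventually_conj[OF r' max] unfolding eventually_nhds_metric by auto
  define t where "t = min d d' / 2"
  have t: "0 < t" "t < d" "t < d'" using d d' by (auto simp: t_def min_def)
  have "r 0 < r t"
  proof (rule DERIV_pos_imp_increasing_open[OF t(1)])
    fix x assume x: "0 < x" "x < t"
    have "dist x 0 < d'" using x t by simp
    then show "\<exists>y. DERIV r x :> y \<and> 0 < y"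
      using d'(2)[of x] d(2)[of x] x t assms(2) by auto
  next
    show "continuous_on {0..t} r"
    proof (rule continuous_at_imp_continuous_on, rule ballI)
      fix x assume "x \<in> {0..t}"
      then have "dist x 0 < d'" using t by simp
      then show "isCont r x" using d'(2) DERIV_isCont by blast
    qed
  qed
  moreover have "r t \<le> r 0" using d'(2)[of t] t by simp
  ultimately show False by simp
qed

text \<open>Mean value inequality on a compact ball. As \<open>Ck_on\<close> provides continuity of
  \<open>f' x v\<close> for each fixed direction \<open>v\<close>, the operator norm is controlled
  by summing bounds over the basis.\<close>

lemma Ck_on_1_locally_lipschitz:
  fixes f :: "'a::euclidean_space \<Rightarrow> 'b::real_normed_vector"
  assumes "open S" "Ck_on 1 S f" "x \<in> S"
  obtains C d where "0 \<le> C" "0 < d" "cball x d \<subseteq> S"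
    "\<And>u v. u \<in> cball x d \<Longrightarrow> v \<in> cball x d \<Longrightarrow> norm (f u - f v) \<le> C * norm (u - v)"
proof -
  obtain f' where f': "\<And>x. x \<in> S \<Longrightarrow> (f has_derivative f' x) (at x)"
    "\<And>v. continuous_on S (\<lambda>x. f' x v)"
    using assms(2) unfolding One_nat_def Ck_on.simps by blast
  obtain d where d: "0 < d" "cball x d \<subseteq> S" using assms open_contains_cball by blast
  have "\<exists>B. \<forall>u\<in>cball x d. norm (f' u b) \<le> B" for b
  proof -
    have "compact ((\<lambda>u. f' u b) ` cball x d)"
      by (intro compact_continuous_image continuous_on_subset[OF f'(2) d(2)] compact_cball)
    from compact_imp_bounded[OF this] show ?thesis unfolding bounded_iff by blast
  qed
  then obtain B where B: "\<And>b u. u \<in> cball x d \<Longrightarrow> norm (f' u b) \<le> B b" by metis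
  have B0: "0 \<le> B b" for b using B[of x b] d(1) by (meson centre_in_cball less_imp_le norm_ge_zero order_trans)
  show ?thesis
  proof (rule that)
    show "0 \<le> (\<Sum>b\<in>Basis. B b)" by (intro sum_nonneg B0)
    show "0 < d" "cball x d \<subseteq> S" by fact+
    fix u v assume uv: "u \<in> cball x d" "v \<in> cball x d"
    show "norm (f u - f v) \<le> (\<Sum>b\<in>Basis. B b) * norm (u - v)"
    proof (rule differentiable_bound[of "cball x d" f f'])
      fix z assume z: "z \<in> cball x d"
      then have der: "(f has_derivative f' z) (at z)" using f'(1) d(2) by auto
      then show "(f has_derivative f' z) (at z within cball x d)" by (rule has_derivative_at_withinI)
      have "onorm (f' z) \<le> (\<Sum>b\<in>Basis. norm (f' z b))"
        using der by (intro onorm_componentwise has_derivative_bounded_linear)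
      also have "\<dots> \<le> (\<Sum>b\<in>Basis. B b)" by (intro sum_mono B z)
      finally show "onorm (f' z) \<le> (\<Sum>b\<in>Basis. B b)" .
    qed (use uv in auto)
  qed
qed

text \<open>A slice chart with chosen derivatives. The directional derivatives of \<open>g\<close>
  are recorded as C1 because the second fundamental form is read off from the derivative of
  \<open>g'\<close>.\<close>

locale slice_chart =
  fixes M U V S :: "'b::euclidean_space set" and h g :: "'b \<Rightarrow> 'b" and h' g' :: "'b \<Rightarrow> 'b \<Rightarrow> 'b"
  assumes open_U: "open U" and open_V: "open V" and homeo: "homeomorphism U V h g"
    and h': "\<And>x. x \<in> U \<Longrightarrow> (h has_derivative h' x) (at x)"
    and h_C1: "Ck_on 1 U h"
    and g': "\<And>x. x \<in> V \<Longrightarrow> (g has_derivative g' x) (at x)"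
    and g'_C1: "\<And>v. Ck_on 1 V (\<lambda>x. g' x v)"
    and subspace_S: "subspace S" and slice: "h ` (M \<inter> U) = V \<inter> S"
begin

lemma g_h: "x \<in> U \<Longrightarrow> g (h x) = x"
  and h_g: "x \<in> V \<Longrightarrow> h (g x) = x"
  and h_in: "x \<in> U \<Longrightarrow> h x \<in> V"
  and g_in: "x \<in> V \<Longrightarrow> g x \<in> U"
  using homeo unfolding homeomorphism_def by auto

lemma g_in_M: "s \<in> V \<Longrightarrow> s \<in> S \<Longrightarrow> g s \<in> M"
  using slice g_h by (metis IntE IntI imageE)

lemma linear_g': "x \<in> V \<Longrightarrow> linear (g' x)"
  using g' has_derivative_linear by blast

lemma g'_h':
  assumes "x \<in> U" shows "g' (h x) (h' x w) = w"
proof -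
  have "((\<lambda>x. g (h x)) has_derivative (\<lambda>w. g' (h x) (h' x w))) (at x)"
    using has_derivative_compose[OF h'[OF assms] g'[OF h_in[OF assms]]] .
  moreover have "((\<lambda>x. g (h x)) has_derivative (\<lambda>w. w)) (at x)"
    by (rule has_derivative_transform_within_open[OF has_derivative_ident open_U assms]) (simp add: g_h)
  ultimately have "(\<lambda>w. g' (h x) (h' x w)) = (\<lambda>w. w)" by (rule has_derivative_unique)
  then show ?thesis by metis
qed

lemma h'_g':
  assumes "s \<in> V" shows "h' (g s) (g' s w) = w"
proof -
  have "((\<lambda>x. h (g x)) has_derivative (\<lambda>w. h' (g s) (g' s w))) (at s)"
    using has_derivative_compose[OF g'[OF assms] h'[OF g_in[OF assms]]] .
  moreover have "((\<lambda>x. h (g x)) has_derivative (\<lambda>w. w)) (at s)"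
    by (rule has_derivative_transform_within_open[OF has_derivative_ident open_V assms]) (simp add: h_g)
  ultimately have "(\<lambda>w. h' (g s) (g' s w)) = (\<lambda>w. w)" by (rule has_derivative_unique)
  then show ?thesis by metis
qed

lemma line_in_V:
  assumes "s \<in> V" shows "\<forall>\<^sub>F t in nhds (0::real). s + t *\<^sub>R e \<in> V"
proof -
  have "((\<lambda>t. s + t *\<^sub>R e) \<longlongrightarrow> s + 0 *\<^sub>R e) (nhds 0)"
    by (intro tendsto_intros filterlim_ident)
  then show ?thesis using open_V assms topological_tendstoD[of _ "s + 0 *\<^sub>R e"] by auto
qed

lemma slice_curve_in_M:
  assumes "s \<in> V" "s \<in> S" "e \<in> S"
  shows "\<forall>\<^sub>F t in nhds (0::real). g (s + t *\<^sub>R e) \<in> M"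
  using line_in_V[OF assms(1), of e]
proof eventually_elim
  case (elim t)
  have "s + t *\<^sub>R e \<in> S" using assms subspace_S by (simp add: subspace_add subspace_mul)
  with elim show ?case by (rule g_in_M)
qed

lemma has_derivative_line:
  assumes "(F has_derivative F') (at (s + t *\<^sub>R e))"
  shows "((\<lambda>t. F (s + t *\<^sub>R e)) has_vector_derivative F' e) (at t)"
proof -
  have "((\<lambda>t. s + t *\<^sub>R e) has_derivative (\<lambda>t. t *\<^sub>R e)) (at t)"
    by (auto intro!: derivative_eq_intros)
  from has_derivative_compose[OF this assms]
  have "((\<lambda>t. F (s + t *\<^sub>R e)) has_derivative (\<lambda>t. F' (t *\<^sub>R e))) (at t)" .
  then show ?thesis
    using has_derivative_linear[OF assms] by (simp add: has_vector_derivative_def linear_scale)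
qed

lemma slice_curve_derivative:
  assumes "s \<in> V"
  shows "((\<lambda>t. g (s + t *\<^sub>R e)) has_vector_derivative g' s e) (at 0)"
  using has_derivative_line[of g "g' s" s 0 e] g'[OF assms] by simp

end

lemma slice_chart_exists:
  fixes M :: "'b::euclidean_space set"
  assumes "smooth_submanifold k M" "p \<in> M"
  shows "\<exists>U V S h g h' g'. slice_chart M U V S h g h' g' \<and> p \<in> U"
  using bspec[OF assms(1)[unfolded smooth_submanifold_def] assms(2)]
proof (elim exE)
  fix U V S :: "'b set" and h g :: "'b \<Rightarrow> 'b"
  assume "open U \<and> p \<in> U \<and> open V \<and> homeomorphism U V h g \<and>
      smooth_on U h \<and> smooth_on V g \<and> subspace S \<and> dim S = k \<and> h ` (M \<inter> U) = V \<inter> S"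
  then have *: "open U" "p \<in> U" "open V" "homeomorphism U V h g"
      "smooth_on U h" "smooth_on V g" "subspace S" "h ` (M \<inter> U) = V \<inter> S"
    by simp_all
  have h1: "Ck_on 1 U h" and g2: "Ck_on (Suc (Suc 0)) V g"
    using *(5,6) unfolding smooth_on_def by blast+
  obtain h' where h': "\<And>x. x \<in> U \<Longrightarrow> (h has_derivative h' x) (at x)"
    using h1 unfolding One_nat_def Ck_on.simps by blast
  obtain g' where g': "\<And>x. x \<in> V \<Longrightarrow> (g has_derivative g' x) (at x)"
      "\<And>v. Ck_on 1 V (\<lambda>x. g' x v)"
    using g2[unfolded Ck_on.simps(2)[of "Suc 0"]] unfolding One_nat_def by blast
  have "slice_chart M U V S h g h' g'"
    by (intro slice_chart.intro) (fact * h1 h' g')+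
  with *(2) show ?thesis by blast
qed

section \<open>Differentiability of the projection\<close>

locale smooth_positive_reach = positive_reach +
  fixes k assumes smooth: "smooth_submanifold k M"
begin

lemma minimizer_orthogonal_slice:
  assumes "slice_chart M U V S h g h' g'" "s \<in> V" "s \<in> S" "e \<in> S" "P y = g s"
  shows "(y - g s) \<bullet> g' s e = 0"
proof -
  interpret slice_chart M U V S h g h' g' by fact
  have "\<forall>\<^sub>F t in at 0. g (s + t *\<^sub>R e) \<in> M"
    using slice_curve_in_M[OF assms(2-4)] by (simp add: eventually_nhds_conv_at)
  then have "\<forall>\<^sub>F t in at 0. dist y (g (s + 0 *\<^sub>R e)) \<le> dist y (g (s + t *\<^sub>R e))"
    by eventually_elim (use P_le[of _ y] assms(5) in \<open>auto simp: dist_norm\<close>)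
  from minimizer_orthogonal[OF slice_curve_derivative[OF assms(2)] this] show ?thesis by simp
qed

text \<open>
  The second fundamental form in direction \<open>v\<close> is at most \<open>norm v / \<tau>\<close>: a ball of radius \<open>\<tau>\<close> touches
  \<open>M\<close> from outside.
\<close>

lemma second_fundamental_form_le:
  assumes "slice_chart M U V S h g h' g'" "s \<in> V" "s \<in> S" "e \<in> S" "P y = g s"
    and g'': "((\<lambda>x. g' x e) has_derivative g'') (at s)"
  shows "(y - g s) \<bullet> g'' e \<le> height y / \<tau> * norm (g' s e) ^ 2"
proof -
  interpret slice_chart M U V S h g h' g' by fact
  define v where "v = y - g s"
  define c where "c t = g (s + t *\<^sub>R e)" for t
  define c' where "c' t = g' (s + t *\<^sub>R e) e" for t
  define \<kappa> where "\<kappa> = height y / \<tau>"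
  \<comment> \<open>For nonzero \<open>v\<close>, \<open>r t \<le> 0\<close> says that
    \<open>c t\<close> avoids the open ball of radius \<tau> that touches \<open>M\<close> at
    \<open>g s\<close> on the side of \<open>v\<close>. So \<open>r\<close> is maximal at 0, and its
    second derivative there is the left side of the claim minus the right side.\<close>
  define r where "r t = v \<bullet> (c t - g s) - \<kappa> / 2 * ((c t - g s) \<bullet> (c t - g s))" for t
  define r' where "r' t = v \<bullet> c' t - \<kappa> * ((c t - g s) \<bullet> c' t)" for t
  have c0: "c 0 = g s" by (simp add: c_def)
  have c'0: "c' 0 = g' s e" by (simp add: c'_def)
  have c: "(c has_vector_derivative c' t) (at t)" if "s + t *\<^sub>R e \<in> V" for t
    unfolding c_def c'_def by (rule has_derivative_line[OF g'[OF that]])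
  have c': "(c' has_vector_derivative g'' e) (at 0)"
    unfolding c'_def using has_derivative_line[of "\<lambda>x. g' x e" g'' s 0 e] g'' by simp
  have dr: "DERIV r t :> r' t" if "s + t *\<^sub>R e \<in> V" for t
    using c[OF that] unfolding r_def r'_def has_field_derivative_def has_vector_derivative_def
    by (auto intro!: derivative_eq_intros simp: algebra_simps inner_commute)
  have "v \<bullet> g'' e - \<kappa> * norm (g' s e) ^ 2 \<le> 0"
  proof (rule local_max_second_derivative_le_0)
    show "\<forall>\<^sub>F t in nhds 0. DERIV r t :> r' t"
      using line_in_V[OF assms(2), of e] by eventually_elim (rule dr)
    show "r' 0 = 0"
      using minimizer_orthogonal_slice[OF assms(1-5)] by (simp add: r'_def c0 c'0 v_def)
    show "DERIV r' 0 :> v \<bullet> g'' e - \<kappa> * norm (g' s e) ^ 2"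
      using c[of 0] c' assms(2) c'0
      unfolding r'_def has_field_derivative_def has_vector_derivative_def
      by (auto intro!: derivative_eq_intros simp: algebra_simps inner_commute c0 c'0 power2_norm_eq_inner)
    show "\<forall>\<^sub>F t in nhds 0. r t \<le> r 0"
      using slice_curve_in_M[OF assms(2-4)]
    proof eventually_elim
      case (elim t)
      then have ct: "c t \<in> M" by (simp add: c_def)
      have "v \<in> normal_space M (g s)" "norm v = height y"
        using P_normal[of y] assms(5) by (auto simp: v_def height_def)
      then have "2 * \<tau> * \<bar>(c t - g s) \<bullet> v\<bar> \<le> norm (c t - g s) ^ 2 * height y"
        using inner_normal_le[OF g_in_M[OF assms(2,3)] ct, of v] by simp
      then have "2 * \<tau> * ((c t - g s) \<bullet> v) \<le> norm (c t - g s) ^ 2 * height y"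
        using \<tau>_pos by (auto intro: order_trans[rotated])
      then have "v \<bullet> (c t - g s) \<le> \<kappa> / 2 * norm (c t - g s) ^ 2"
        using \<tau>_pos by (simp add: \<kappa>_def field_simps inner_commute)
      then show "r t \<le> r 0" by (simp add: r_def c0 power2_norm_eq_inner)
    qed
  qed
  then show ?thesis by (simp add: v_def \<kappa>_def)
qed

lemma P_eventually_in_U:
  assumes "y \<in> tube" "open U" "P y \<in> U" shows "\<forall>\<^sub>F z in nhds y. P z \<in> U"
  using P_isCont[OF assms(1)] assms(2,3) unfolding isCont_def tendsto_at_iff_tendsto_nhds
  by (rule topological_tendstoD)

lemma h_P_lipschitz:
  assumes "slice_chart M U V S h g h' g'" "y \<in> tube" "P y \<in> U"
  obtains K where "\<forall>\<^sub>F z in nhds y. norm (h (P z) - h (P y)) \<le> K * norm (z - y)"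
proof -
  interpret slice_chart M U V S h g h' g' by fact
  obtain C d where C: "0 \<le> C" "0 < d" "\<And>u v. u \<in> cball (P y) d \<Longrightarrow> v \<in> cball (P y) d \<Longrightarrow>
      norm (h u - h v) \<le> C * norm (u - v)"
    using Ck_on_1_locally_lipschitz[OF open_U h_C1 assms(3)] by metis
  obtain C' where C': "0 < C'" "\<forall>\<^sub>F z in nhds y. norm (P z - P y) \<le> C' * norm (z - y)"
    using P_locally_lipschitz[OF assms(2)] .
  have "\<forall>\<^sub>F z in nhds y. P z \<in> ball (P y) d"
    by (rule P_eventually_in_U[OF assms(2)]) (use C(2) in auto)
  with C'(2) have "\<forall>\<^sub>F z in nhds y. norm (h (P z) - h (P y)) \<le> (C * C') * norm (z - y)"
  proof eventually_elim
    case (elim z)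
    have "norm (h (P z) - h (P y)) \<le> C * norm (P z - P y)"
      using elim C by (intro C(3)) (auto simp: less_imp_le)
    also have "\<dots> \<le> C * (C' * norm (z - y))" using elim C(1) by (intro mult_left_mono) auto
    finally show ?case by (simp add: mult_ac)
  qed
  then show ?thesis using that by blast
qed

text \<open>
  In a chart the coordinates \<open>\<sigma> z = h (P z)\<close> of the projection solve the normal equations
  \<open>(z - g \<sigma>) \<bullet> g' \<sigma> b = 0\<close>, where \<open>b\<close> runs through a basis of the slice. The derivative of this system with
  respect to \<open>\<sigma>\<close> is invertible because \<open>y\<close> is closer to \<open>M\<close> than any focal point. The last two summands
  of \<open>\<Phi>\<close> make the system square.
\<close>

lemma P_differentiable:
  assumes y: "y \<in> tube" shows "P differentiable (at y)"
proof -
  obtain U V S h g h' g' where chart: "slice_chart M U V S h g h' g'" and PU: "P y \<in> U"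
    using slice_chart_exists[OF smooth P_in[of y]] by blast
  interpret slice_chart M U V S h g h' g' by fact
  define \<sigma> where "\<sigma> z = h (P z)" for z
  define s where "s = \<sigma> y"
  have sV: "s \<in> V" and gs: "g s = P y" using PU by (auto simp: s_def \<sigma>_def h_in g_h)
  have \<sigma>: "\<sigma> z \<in> V" "\<sigma> z \<in> S" "g (\<sigma> z) = P z" if "P z \<in> U" for z
    using that P_in[of z] slice by (auto simp: \<sigma>_def g_h)
  have sS: "s \<in> S" using \<sigma>(2)[OF PU] by (simp add: s_def)
  obtain B where B: "B \<subseteq> S" "pairwise orthogonal B" "\<And>x. x \<in> B \<Longrightarrow> norm x = 1"
    "independent B" "span B = S"
    using orthonormal_basis_subspace[OF subspace_S] by metis
  have fB: "finite B" using B(4) by (rule independent_imp_finite)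
  have exp: "(\<Sum>b\<in>B. (e \<bullet> b) *\<^sub>R b) = e" if "e \<in> S" for e
    using orthonormal_basis_expand[OF B(2,3) _ fB] that B(5) by metis
  have coeff: "(\<Sum>b\<in>B. c b *\<^sub>R b) \<bullet> a = c a" if "a \<in> B" for c a
  proof -
    have "(\<Sum>b\<in>B. c b *\<^sub>R b) \<bullet> a = (\<Sum>b\<in>B. if b = a then c b else 0)"
      unfolding inner_sum_left
    proof (rule sum.cong)
      fix b assume "b \<in> B"
      with that B(2) B(3)[of a] show "c b *\<^sub>R b \<bullet> a = (if b = a then c b else 0)"
        by (auto simp: pairwise_def orthogonal_def simp flip: power2_norm_eq_inner)
    qed simp
    then show ?thesis using that fB by simp
  qed
  have "\<exists>g''. ((\<lambda>x. g' x e) has_derivative g'') (at s)" for e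
    using g'_C1[of e] sV unfolding One_nat_def Ck_on.simps by blast
  then obtain g'' where g'': "\<And>e. ((\<lambda>x. g' x e) has_derivative g'' e) (at s)" by metis
  \<comment> \<open>The first sum collects the normal equations as a vector of \<open>S\<close>; the
    rest is the component of \<open>snd p - s\<close> orthogonal to \<open>S\<close>, which vanishes
    for \<open>snd p = \<sigma> z\<close> because \<open>\<sigma> z - s\<close> lies in
    \<open>S\<close>.\<close>
  define \<Phi> where "\<Phi> p = (\<Sum>b\<in>B. ((fst p - g (snd p)) \<bullet> g' (snd p) b) *\<^sub>R b)
    + ((snd p - s) - (\<Sum>b\<in>B. ((snd p - s) \<bullet> b) *\<^sub>R b))" for p :: "'a \<times> 'a"
  define \<Phi>' where "\<Phi>' p = (\<Sum>b\<in>B. ((y - g s) \<bullet> g'' b (snd p) + (fst p - g' s (snd p)) \<bullet> g' s b) *\<^sub>R b)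
    + (snd p - (\<Sum>b\<in>B. (snd p \<bullet> b) *\<^sub>R b))" for p :: "'a \<times> 'a"
  have snd_der: "(snd has_derivative snd) (at (y, s))"
    by (rule has_derivative_snd[OF has_derivative_ident])
  have g_snd: "((\<lambda>p. g (snd p)) has_derivative (\<lambda>p. g' s (snd p))) (at (y, s))"
    using has_derivative_compose[OF snd_der, of g "g' s"] g'[OF sV] by simp
  have g'_snd: "((\<lambda>p. g' (snd p) b) has_derivative (\<lambda>p. g'' b (snd p))) (at (y, s))" for b
    using has_derivative_compose[OF snd_der, of "\<lambda>x. g' x b" "g'' b"] g''[of b] by simp
  have \<Phi>_der: "(\<Phi> has_derivative \<Phi>') (at (y, \<sigma> y))"
    unfolding \<Phi>_def \<Phi>'_def s_def[symmetric]
    by (auto intro!: derivative_eq_intros g_snd g'_snd)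
  have zero: "\<forall>\<^sub>F z in nhds y. \<Phi> (z, \<sigma> z) = 0"
    using P_eventually_in_U[OF y open_U PU]
  proof eventually_elim
    case (elim z)
    have "(z - g (\<sigma> z)) \<bullet> g' (\<sigma> z) b = 0" if "b \<in> B" for b
      using minimizer_orthogonal_slice[OF chart \<sigma>(1,2)[OF elim], of b z] \<sigma>(3)[OF elim] that B(1) by auto
    moreover have "\<sigma> z - s \<in> S" using \<sigma>(2)[OF elim] sS subspace_S by (simp add: subspace_diff)
    ultimately show ?case by (simp add: \<Phi>_def exp)
  qed
  obtain K where K: "\<forall>\<^sub>F z in nhds y. norm (\<sigma> z - \<sigma> y) \<le> K * norm (z - y)"
    unfolding \<sigma>_def using h_P_lipschitz[OF chart y PU] .
  have lin: "linear (\<lambda>\<delta>. \<Phi>' (0, \<delta>))"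
    using bounded_linear_compose[OF has_derivative_bounded_linear[OF \<Phi>_der]
        bounded_linear_Pair[OF bounded_linear_zero bounded_linear_ident]]
    by (simp add: bounded_linear.linear)
  have "inj (\<lambda>\<delta>. \<Phi>' (0, \<delta>))"
    unfolding linear_injective_0[OF lin]
  proof (intro allI impI)
    fix \<delta> assume \<delta>: "\<Phi>' (0, \<delta>) = 0"
    let ?c = "\<lambda>b. (y - g s) \<bullet> g'' b \<delta> - g' s \<delta> \<bullet> g' s b"
    have c0: "?c b = 0" if "b \<in> B" for b
      using arg_cong[OF \<delta>, of "\<lambda>x. x \<bullet> b"] that
      by (simp add: \<Phi>'_def inner_add_left inner_diff_left coeff)
    have "(\<Sum>b\<in>B. ?c b *\<^sub>R b) = 0" by (rule sum.neutral) (simp add: c0)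
    \<comment> \<open>Once the part in \<open>S\<close> is known to vanish, the remaining part says
      that \<delta> equals its orthogonal projection to \<open>S\<close>.\<close>
    then have "\<delta> = (\<Sum>b\<in>B. (\<delta> \<bullet> b) *\<^sub>R b)"
      using \<delta> by (simp add: \<Phi>'_def algebra_simps)
    moreover have "(\<Sum>b\<in>B. (\<delta> \<bullet> b) *\<^sub>R b) \<in> span B"
      by (intro span_sum span_scale span_base)
    ultimately have \<delta>S: "\<delta> \<in> S" using B(5) by metis
    have g'_exp: "g' x \<delta> = (\<Sum>b\<in>B. (\<delta> \<bullet> b) *\<^sub>R g' x b)" if "x \<in> V" for x
      using linear_sum[OF linear_g'[OF that], of "\<lambda>b. (\<delta> \<bullet> b) *\<^sub>R b" B] exp[OF \<delta>S]
      by (simp add: linear_scale[OF linear_g'[OF that]])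
    have "((\<lambda>x. \<Sum>b\<in>B. (\<delta> \<bullet> b) *\<^sub>R g' x b) has_derivative (\<lambda>d. \<Sum>b\<in>B. (\<delta> \<bullet> b) *\<^sub>R g'' b d)) (at s)"
      by (intro derivative_intros g'')
    then have "((\<lambda>x. g' x \<delta>) has_derivative (\<lambda>d. \<Sum>b\<in>B. (\<delta> \<bullet> b) *\<^sub>R g'' b d)) (at s)"
      by (rule has_derivative_transform_within_open[OF _ open_V sV]) (simp add: g'_exp)
    from second_fundamental_form_le[OF chart sV sS \<delta>S _ this, of y]
    have le: "(y - g s) \<bullet> (\<Sum>b\<in>B. (\<delta> \<bullet> b) *\<^sub>R g'' b \<delta>) \<le> height y / \<tau> * norm (g' s \<delta>) ^ 2"
      by (simp add: gs)
    \<comment> \<open>Weighting the kernel equations with the coordinates of \<delta> turns the left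
      side of \<open>le\<close> into \<open>norm (g' s \<delta>) ^ 2\<close>. Inside the tube
      \<open>height y / \<tau>\<close> is below 1, so \<open>g' s \<delta>\<close> must be
      0.\<close>
    have "(y - g s) \<bullet> (\<Sum>b\<in>B. (\<delta> \<bullet> b) *\<^sub>R g'' b \<delta>) = (\<Sum>b\<in>B. (\<delta> \<bullet> b) * ((y - g s) \<bullet> g'' b \<delta>))"
      by (simp add: inner_sum_right)
    also have "\<dots> = (\<Sum>b\<in>B. (\<delta> \<bullet> b) * (g' s \<delta> \<bullet> g' s b))"
      by (rule sum.cong) (use c0 in auto)
    also have "\<dots> = g' s \<delta> \<bullet> (\<Sum>b\<in>B. (\<delta> \<bullet> b) *\<^sub>R g' s b)"
      by (simp add: inner_sum_right)
    also have "\<dots> = norm (g' s \<delta>) ^ 2"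
      using g'_exp[OF sV] by (simp add: power2_norm_eq_inner)
    finally have "norm (g' s \<delta>) ^ 2 \<le> height y / \<tau> * norm (g' s \<delta>) ^ 2" using le by simp
    moreover have "height y / \<tau> < 1" using y \<tau>_pos by (simp add: tube_def)
    ultimately have "g' s \<delta> = 0"
      by (metis mult_less_cancel_right2 norm_eq_zero not_le power2_eq_square power_zero_numeral
          zero_less_power2)
    then show "\<delta> = 0" using h'_g'[OF sV, of \<delta>] linear_0[OF has_derivative_linear[OF h'[OF PU]]] gs by simp
  qed
  then obtain R where R: "linear R" "R \<circ> (\<lambda>\<delta>. \<Phi>' (0, \<delta>)) = id"
    using linear_injective_left_inverse[OF lin] by blast
  have "(\<sigma> has_derivative (\<lambda>w. - R (\<Phi>' (w, 0)))) (at y)"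
    using R by (intro implicit_function_derivative[OF \<Phi>_der zero K])
      (auto simp: linear_linear fun_eq_iff)
  from has_derivative_compose[OF this, of g "g' s"]
  have "((\<lambda>z. g (\<sigma> z)) has_derivative (\<lambda>w. g' s (- R (\<Phi>' (w, 0))))) (at y)"
    using g'[OF sV] by (simp add: s_def)
  moreover have "\<forall>\<^sub>F z in at y. g (\<sigma> z) = P z"
    using P_eventually_in_U[OF y open_U PU] \<sigma>(3) by (auto simp: eventually_nhds_conv_at elim: eventually_mono)
  ultimately have "(P has_derivative (\<lambda>w. g' s (- R (\<Phi>' (w, 0))))) (at y)"
    by (rule has_derivative_transform_eventually) (use \<sigma>(3)[OF PU] in auto)
  then show ?thesis by (rule differentiableI)
qed

end

section \<open>The derivative of the projection\<close>

lemma difference_quotient_tendsto: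
  fixes f :: "real \<Rightarrow> 'a::real_normed_vector"
  assumes "(f has_vector_derivative w) (at 0)"
  shows "((\<lambda>t. (f t - f 0) /\<^sub>R t) \<longlongrightarrow> w) (at 0)"
proof -
  have "((\<lambda>t. norm (f t - f 0 - t *\<^sub>R w) / norm t) \<longlongrightarrow> 0) (at 0)"
    using assms unfolding has_vector_derivative_def has_derivative_at by simp
  then have "((\<lambda>t. norm ((f t - f 0) /\<^sub>R t - w)) \<longlongrightarrow> 0) (at 0)"
  proof (rule Lim_transform_eventually)
    have "norm (f t - f 0 - t *\<^sub>R w) / norm t = norm ((f t - f 0) /\<^sub>R t - w)" if "t \<noteq> 0" for t
    proof -
      have "(f t - f 0) /\<^sub>R t - w = (f t - f 0 - t *\<^sub>R w) /\<^sub>R t"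
        using that by (simp add: scaleR_right_diff_distrib)
      then show ?thesis by (simp add: divide_inverse mult.commute)
    qed
    then show "\<forall>\<^sub>F t in at 0. norm (f t - f 0 - t *\<^sub>R w) / norm t = norm ((f t - f 0) /\<^sub>R t - w)"
      by (auto simp: eventually_at_filter)
  qed
  then show ?thesis by (simp add: tendsto_norm_zero_iff LIM_zero_iff)
qed

text \<open>The second difference \<Delta> is symmetric in \<open>a\<close> and \<open>b\<close>,
  and the mean value theorem along \<open>b\<close> shows that it is
  \<open>t ^ 2 * (L a \<bullet> b)\<close> up to smaller order. Differentiability of
  \<open>F\<close> is asked at one point only, which suits the projection: its derivative is not
  known to be continuous.\<close>

lemma derivative_of_gradient_symmetric:
  fixes F :: "'a::real_inner \<Rightarrow> 'a" and \<phi> :: "'a \<Rightarrow> real"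
  assumes S: "open S" "y \<in> S"
    and \<phi>: "\<And>x. x \<in> S \<Longrightarrow> (\<phi> has_derivative (\<lambda>w. F x \<bullet> w)) (at x)"
    and F: "(F has_derivative L) (at y)"
  shows "L a \<bullet> b = L b \<bullet> a"
proof -
  interpret L: bounded_linear L using F by (rule has_derivative_bounded_linear)
  define \<Delta> where "\<Delta> a b t = \<phi> (y + t *\<^sub>R a + t *\<^sub>R b) - \<phi> (y + t *\<^sub>R a) - \<phi> (y + t *\<^sub>R b) + \<phi> y"
    for a b and t :: real
  have main: "\<forall>\<^sub>F t in at_right 0. \<bar>\<Delta> a b t - t ^ 2 * (L a \<bullet> b)\<bar> \<le> e * t ^ 2" if e: "e > 0" for a b e
  proof -
    define c where "c = norm a + norm b + 1"
    have c: "c > 0" unfolding c_def by (intro add_nonneg_pos) auto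
    \<comment> \<open>Two remainders of size \<open>e' * (c * t)\<close> get paired with
      \<open>b\<close>. The summands 1 here and in \<open>c\<close> keep the denominator positive
      when \<open>a\<close> or \<open>b\<close> is 0.\<close>
    define e' where "e' = e / (2 * c * (norm b + 1))"
    have e': "e' > 0" using e c by (auto simp: e'_def intro!: divide_pos_pos mult_pos_pos add_nonneg_pos)
    obtain d where d: "d > 0" "\<And>x. norm (x - y) < d \<Longrightarrow> norm (F x - F y - L (x - y)) \<le> e' * norm (x - y)"
      using F e' unfolding has_derivative_at_alt by meson
    obtain d' where d': "d' > 0" "ball y d' \<subseteq> S" using S open_contains_ball by blast
    have "\<bar>\<Delta> a b t - t ^ 2 * (L a \<bullet> b)\<bar> \<le> e * t ^ 2" if t: "0 < t" "t < min d d' / c" for t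
    proof -
      have near: "norm (u *\<^sub>R a + s *\<^sub>R b) \<le> c * t" if "0 \<le> s" "s \<le> t" "0 \<le> u" "u \<le> t" for s u
      proof -
        have "norm (u *\<^sub>R a + s *\<^sub>R b) \<le> u * norm a + s * norm b"
          using norm_triangle_ineq[of "u *\<^sub>R a" "s *\<^sub>R b"] that by simp
        also have "\<dots> \<le> t * norm a + t * norm b + t"
          using mult_right_mono[OF that(4), of "norm a"] mult_right_mono[OF that(2), of "norm b"] t(1)
          by simp
        finally show ?thesis by (simp add: c_def algebra_simps)
      qed
      have ct: "c * t < d" "c * t < d'" using t c by (auto simp: field_simps)
      define \<xi> where "\<xi> s = \<phi> (y + t *\<^sub>R a + s *\<^sub>R b) - \<phi> (y + s *\<^sub>R b)" for s
      have d\<phi>: "((\<lambda>s. \<phi> (y + u *\<^sub>R a + s *\<^sub>R b)) has_derivative (\<lambda>h. F (y + u *\<^sub>R a + s *\<^sub>R b) \<bullet> (h *\<^sub>R b))) (at s)"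
        if "0 \<le> s" "s \<le> t" "0 \<le> u" "u \<le> t" for s u
      proof -
        have a: "((\<lambda>s. y + u *\<^sub>R a + s *\<^sub>R b) has_derivative (\<lambda>h. h *\<^sub>R b)) (at s)"
          by (auto intro!: derivative_eq_intros)
        have "dist (y + u *\<^sub>R a + s *\<^sub>R b) y < d'"
          using near[OF that] ct by (simp add: dist_norm add.assoc)
        then have b: "(\<phi> has_derivative (\<bullet>) (F (y + u *\<^sub>R a + s *\<^sub>R b))) (at (y + u *\<^sub>R a + s *\<^sub>R b))"
          using d'(2) by (intro \<phi>) (auto simp: dist_commute)
        from has_derivative_compose[OF a b] show ?thesis .
      qed
      have "\<exists>s>0. s < t \<and> \<xi> t - \<xi> 0 = (t - 0) * ((F (y + t *\<^sub>R a + s *\<^sub>R b) - F (y + s *\<^sub>R b)) \<bullet> b)"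
      proof (rule MVT2[OF t(1)])
        fix s assume s: "0 \<le> s" "s \<le> t"
        show "DERIV \<xi> s :> (F (y + t *\<^sub>R a + s *\<^sub>R b) - F (y + s *\<^sub>R b)) \<bullet> b"
          unfolding has_field_derivative_def
        proof (rule has_derivative_eq_rhs)
          show "(\<xi> has_derivative (\<lambda>h. F (y + t *\<^sub>R a + s *\<^sub>R b) \<bullet> (h *\<^sub>R b) - F (y + s *\<^sub>R b) \<bullet> (h *\<^sub>R b))) (at s)"
            using has_derivative_diff[OF d\<phi>[OF s, of t] d\<phi>[OF s, of 0]] t(1)
            by (simp add: \<xi>_def[abs_def])
        qed (auto simp: inner_diff_left algebra_simps)
      qed
      then obtain s where s: "0 < s" "s < t"
        "\<xi> t - \<xi> 0 = t * ((F (y + t *\<^sub>R a + s *\<^sub>R b) - F (y + s *\<^sub>R b)) \<bullet> b)" by auto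
      define R where "R x = F x - F y - L (x - y)" for x
      have R: "norm (R (y + u *\<^sub>R a + s *\<^sub>R b)) \<le> e' * (c * t)" if "0 \<le> u" "u \<le> t" for u
      proof -
        have n: "norm (y + u *\<^sub>R a + s *\<^sub>R b - y) \<le> c * t"
          using near[of s u] s that by (simp add: add.assoc)
        then have "norm (R (y + u *\<^sub>R a + s *\<^sub>R b)) \<le> e' * norm (y + u *\<^sub>R a + s *\<^sub>R b - y)"
          unfolding R_def using ct by (intro d(2)) auto
        also have "\<dots> \<le> e' * (c * t)" using n e' by (intro mult_left_mono) auto
        finally show ?thesis .
      qed
      have "\<Delta> a b t = \<xi> t - \<xi> 0" by (simp add: \<Delta>_def \<xi>_def)
      also have "F (y + t *\<^sub>R a + s *\<^sub>R b) - F (y + s *\<^sub>R b)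
          = t *\<^sub>R L a + (R (y + t *\<^sub>R a + s *\<^sub>R b) - R (y + 0 *\<^sub>R a + s *\<^sub>R b))"
        by (simp add: R_def L.add L.scaleR L.diff)
      note s(3)[unfolded this]
      finally have "\<Delta> a b t - t ^ 2 * (L a \<bullet> b)
          = t * ((R (y + t *\<^sub>R a + s *\<^sub>R b) - R (y + 0 *\<^sub>R a + s *\<^sub>R b)) \<bullet> b)"
        by (simp add: algebra_simps inner_add_left inner_diff_left power2_eq_square)
      then have "\<bar>\<Delta> a b t - t ^ 2 * (L a \<bullet> b)\<bar>
          \<le> t * (norm (R (y + t *\<^sub>R a + s *\<^sub>R b) - R (y + 0 *\<^sub>R a + s *\<^sub>R b)) * norm b)"
        using t(1) Cauchy_Schwarz_ineq2 by (simp add: abs_mult)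
      also have "\<dots> \<le> t * ((e' * (c * t) + e' * (c * t)) * (norm b + 1))"
        using R[of t] R[of 0] t(1) e' c
        by (intro mult_left_mono mult_mono order_trans[OF norm_triangle_ineq4] add_mono) auto
      also have "\<dots> = e' * (2 * c * (norm b + 1)) * t ^ 2" by (simp add: power2_eq_square)
      also have "e' * (2 * c * (norm b + 1)) = e"
      proof -
        have "norm b + 1 > 0" by (intro add_nonneg_pos) auto
        then show ?thesis using c by (simp add: e'_def)
      qed
      finally show ?thesis .
    qed
    moreover have "min d d' / c > 0" using d(1) d'(1) c by simp
    ultimately show ?thesis unfolding eventually_at_right_field by blast
  qed
  have "\<bar>L a \<bullet> b - L b \<bullet> a\<bar> \<le> 0 + e" if "e > 0" for e
  proof -
    have "\<forall>\<^sub>F t in at_right (0::real). t > 0" by (simp add: eventually_at_right_less)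
    with main[of "e / 2" a b] main[of "e / 2" b a]
    have "\<forall>\<^sub>F t in at_right 0. \<bar>\<Delta> a b t - t ^ 2 * (L a \<bullet> b)\<bar> \<le> e / 2 * t ^ 2 \<and>
        \<bar>\<Delta> b a t - t ^ 2 * (L b \<bullet> a)\<bar> \<le> e / 2 * t ^ 2 \<and> t > 0"
      using that by (auto intro: eventually_conj)
    then obtain t where t: "\<bar>\<Delta> a b t - t ^ 2 * (L a \<bullet> b)\<bar> \<le> e / 2 * t ^ 2"
        "\<bar>\<Delta> b a t - t ^ 2 * (L b \<bullet> a)\<bar> \<le> e / 2 * t ^ 2" "t > 0"
      using eventually_happens'[OF trivial_limit_at_right_real] by blast
    have "\<Delta> a b t = \<Delta> b a t" by (simp add: \<Delta>_def algebra_simps)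
    then have "\<bar>t ^ 2 * (L a \<bullet> b) - t ^ 2 * (L b \<bullet> a)\<bar> \<le> e * t ^ 2" using t(1,2) by linarith
    moreover have "\<bar>t ^ 2 * (L a \<bullet> b) - t ^ 2 * (L b \<bullet> a)\<bar> = t ^ 2 * \<bar>L a \<bullet> b - L b \<bullet> a\<bar>"
      by (simp only: right_diff_distrib[symmetric] abs_mult) simp
    ultimately have "t ^ 2 * \<bar>L a \<bullet> b - L b \<bullet> a\<bar> \<le> t ^ 2 * e" by (simp only: mult.commute)
    then show ?thesis using t(3) by simp
  qed
  then have "\<bar>L a \<bullet> b - L b \<bullet> a\<bar> \<le> 0" by (rule field_le_epsilon)
  then show ?thesis by simp
qed

context smooth_positive_reach
begin

definition D :: "'a \<Rightarrow> 'a \<Rightarrow> 'a" where "D y = frechet_derivative P (at y)"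

lemma D: "y \<in> tube \<Longrightarrow> (P has_derivative D y) (at y)"
  unfolding D_def using P_differentiable frechet_derivative_works by blast

lemma linear_D: "y \<in> tube \<Longrightarrow> linear (D y)"
  using D has_derivative_linear by blast

lemma D_line:
  assumes "y \<in> tube" shows "((\<lambda>t. P (y + t *\<^sub>R w)) has_vector_derivative D y w) (at 0)"
proof -
  have "((\<lambda>t. y + t *\<^sub>R w) has_derivative (\<lambda>t. t *\<^sub>R w)) (at 0)"
    by (auto intro!: derivative_eq_intros)
  moreover have "(P has_derivative D y) (at (y + 0 *\<^sub>R w))" using D[OF assms] by simp
  ultimately have "((\<lambda>t. P (y + t *\<^sub>R w)) has_derivative (\<lambda>t. D y (t *\<^sub>R w))) (at 0)"
    by (rule has_derivative_compose)
  then show ?thesis by (simp add: has_vector_derivative_def linear_scale[OF linear_D[OF assms]])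
qed

text \<open>Obtained by differentiating \<open>P (\<gamma> t) = \<gamma> t\<close>.\<close>

lemma D_curve:
  assumes "(\<gamma> has_vector_derivative w) (at 0)" "\<forall>\<^sub>F t in nhds 0. \<gamma> t \<in> M"
  shows "D (\<gamma> 0) w = w"
proof -
  have M: "\<gamma> 0 \<in> M" using assms(2) by (rule eventually_nhds_x_imp_x)
  have "((\<lambda>t. P (\<gamma> t)) has_vector_derivative D (\<gamma> 0) w) (at 0)"
    using has_derivative_compose[OF assms(1)[unfolded has_vector_derivative_def] D[OF M_tube[OF M]]]
    by (simp add: has_vector_derivative_def linear_scale[OF linear_D[OF M_tube[OF M]]])
  moreover have "\<forall>\<^sub>F t in at 0. P (\<gamma> t) = \<gamma> t"
    using assms(2) by (auto simp: eventually_nhds_conv_at P_self elim: eventually_mono)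
  ultimately have "(\<gamma> has_vector_derivative D (\<gamma> 0) w) (at 0)"
    unfolding has_vector_derivative_def
    by (rule has_derivative_transform_eventually) (auto simp: P_self M)
  then show ?thesis using assms(1) by (rule vector_derivative_unique_at)
qed

text \<open>Obtained by differentiating \<open>P (P x) = P x\<close>; values of \<open>D y\<close>
  are thus tangent at \<open>P y\<close>.\<close>

lemma D_P_D:
  assumes "y \<in> tube" shows "D (P y) (D y w) = D y w"
proof -
  have "((\<lambda>x. P (P x)) has_derivative (\<lambda>w. D (P y) (D y w))) (at y)"
    using has_derivative_compose[OF D[OF assms] D[OF M_tube[OF P_in]]] .
  then have "(P has_derivative (\<lambda>w. D (P y) (D y w))) (at y)" by (simp add: P_self P_in)
  from has_derivative_unique[OF this D[OF assms]] show ?thesis by metis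
qed

text \<open>\<open>P\<close> is the gradient of \<open>?\<phi>\<close>, which is half of
  \<open>norm x ^ 2 - height x ^ 2\<close> and the supremum over \<open>q\<close> in
  \<open>M\<close> of the affine functions \<open>x \<bullet> q - q \<bullet> q / 2\<close>,
  attained at \<open>P x\<close>. Inserting the foot point of \<open>x\<close> at \<open>z\<close>
  and conversely squeezes the first-order error between 0 and
  \<open>(P z - P x) \<bullet> (z - x)\<close>; continuity of \<open>P\<close> makes this
  small.\<close>

lemma D_symmetric:
  assumes "y \<in> tube" shows "D y a \<bullet> b = D y b \<bullet> a"
proof (rule derivative_of_gradient_symmetric[OF open_tube assms _ D[OF assms]])
  let ?\<phi> = "\<lambda>x. x \<bullet> P x - P x \<bullet> P x / 2"
  have sup: "?\<phi> x \<ge> x \<bullet> P z - P z \<bullet> P z / 2" for x z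
  proof -
    have "norm (x - P x) ^ 2 \<le> norm (x - P z) ^ 2" by (intro power_mono P_le P_in) simp
    then show ?thesis by (simp add: power2_norm_eq_inner inner_diff inner_commute algebra_simps)
  qed
  fix x assume x: "x \<in> tube"
  show "(?\<phi> has_derivative (\<bullet>) (P x)) (at x)"
    unfolding has_derivative_at_alt
  proof (intro conjI allI impI)
    show "bounded_linear ((\<bullet>) (P x))" by (rule bounded_linear_inner_right)
    fix e :: real assume e: "e > 0"
    obtain d where d: "d > 0" "\<And>z. norm (z - x) < d \<Longrightarrow> norm (P z - P x) < e"
      using P_isCont[OF x] e unfolding continuous_at_eps_delta dist_norm by blast
    show "\<exists>d>0. \<forall>z. norm (z - x) < d \<longrightarrow> norm (?\<phi> z - ?\<phi> x - P x \<bullet> (z - x)) \<le> e * norm (z - x)"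
    proof (intro exI conjI allI impI)
      fix z assume z: "norm (z - x) < d"
      have "0 \<le> ?\<phi> z - ?\<phi> x - P x \<bullet> (z - x)"
        using sup[of z x] by (simp add: inner_diff inner_commute)
      moreover have "?\<phi> z - ?\<phi> x - P x \<bullet> (z - x) \<le> (P z - P x) \<bullet> (z - x)"
        using sup[of x z] by (simp add: inner_diff inner_commute)
      moreover have "(P z - P x) \<bullet> (z - x) \<le> norm (P z - P x) * norm (z - x)"
        by (rule norm_cauchy_schwarz)
      moreover have "\<dots> \<le> e * norm (z - x)" using d(2)[OF z] by (intro mult_right_mono) auto
      ultimately show "norm (?\<phi> z - ?\<phi> x - P x \<bullet> (z - x)) \<le> e * norm (z - x)" by simp
    qed (fact d(1))
  qed
qed

text \<open>Limit of \<open>inner_P_diff\<close> at \<open>y + t *\<^sub>R w\<close> and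
  \<open>y\<close>, divided by \<open>t ^ 2\<close>; the mean of the two heights tends to
  \<open>height y\<close>.\<close>

lemma D_inner_self:
  assumes "y \<in> tube"
  shows "\<bar>(w - D y w) \<bullet> D y w\<bar> \<le> height y / \<tau> * norm (D y w) ^ 2"
proof -
  define q where "q t = (P (y + t *\<^sub>R w) - P y) /\<^sub>R t" for t
  have q: "(q \<longlongrightarrow> D y w) (at 0)"
    using difference_quotient_tendsto[OF D_line[OF assms, of w]] by (simp add: q_def[abs_def])
  show ?thesis
  proof (rule tendsto_le[OF trivial_limit_at])
    show "((\<lambda>t. \<bar>q t \<bullet> w - norm (q t) ^ 2\<bar>) \<longlongrightarrow> \<bar>(w - D y w) \<bullet> D y w\<bar>) (at (0::real))"
    proof -
      have "((\<lambda>t. \<bar>q t \<bullet> w - norm (q t) ^ 2\<bar>) \<longlongrightarrow> \<bar>D y w \<bullet> w - norm (D y w) ^ 2\<bar>) (at (0::real))"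
        by (intro tendsto_intros q)
      then show ?thesis
        by (simp add: inner_diff_left power2_norm_eq_inner inner_commute[of w "D y w"])
    qed
    have "((\<lambda>t. height (y + t *\<^sub>R w)) \<longlongrightarrow> height (y + 0 *\<^sub>R w)) (at (0::real))"
      unfolding height_infdist by (intro tendsto_intros)
    then have "((\<lambda>t. (height (y + t *\<^sub>R w) + height y) / (2 * \<tau>) * norm (q t) ^ 2) \<longlongrightarrow>
        (height (y + 0 *\<^sub>R w) + height y) / (2 * \<tau>) * norm (D y w) ^ 2) (at (0::real))"
      by (intro tendsto_intros q) (use \<tau>_pos in auto)
    then show "((\<lambda>t. (height (y + t *\<^sub>R w) + height y) / (2 * \<tau>) * norm (q t) ^ 2) \<longlongrightarrow>
        height y / \<tau> * norm (D y w) ^ 2) (at (0::real))" by simp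
    show "\<forall>\<^sub>F t in at 0. \<bar>q t \<bullet> w - norm (q t) ^ 2\<bar>
        \<le> (height (y + t *\<^sub>R w) + height y) / (2 * \<tau>) * norm (q t) ^ 2"
      unfolding eventually_at_filter
    proof (intro always_eventually allI impI)
      fix t :: real assume t: "t \<noteq> 0"
      have Pq: "P (y + t *\<^sub>R w) - P y = t *\<^sub>R q t" using t by (simp add: q_def[abs_def])
      have "t ^ 2 * \<bar>q t \<bullet> w - norm (q t) ^ 2\<bar> = \<bar>t ^ 2 * (q t \<bullet> w - norm (q t) ^ 2)\<bar>"
        by (simp add: abs_mult)
      also have "\<dots> = \<bar>(t *\<^sub>R q t) \<bullet> (t *\<^sub>R w) - norm (t *\<^sub>R q t) ^ 2\<bar>"
        by (simp add: power_mult_distrib algebra_simps power2_eq_square)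
      also have "\<dots> \<le> (height (y + t *\<^sub>R w) + height y) / (2 * \<tau>) * norm (t *\<^sub>R q t) ^ 2"
        using inner_P_diff[of "y + t *\<^sub>R w" y] unfolding Pq by simp
      also have "\<dots> = t ^ 2 * ((height (y + t *\<^sub>R w) + height y) / (2 * \<tau>) * norm (q t) ^ 2)"
        by (simp add: power_mult_distrib)
      finally show "\<bar>q t \<bullet> w - norm (q t) ^ 2\<bar>
        \<le> (height (y + t *\<^sub>R w) + height y) / (2 * \<tau>) * norm (q t) ^ 2"
        using t by (simp only: mult_le_cancel_left) auto
    qed
  qed
qed

text \<open>
  The form \<open>(w, w') \<mapsto> (w - D y w) \<bullet> D y w'\<close> is symmetric, so it obeys the same bound off the diagonal.
\<close>

lemma D_inner:
  assumes y: "y \<in> tube"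
  shows "\<bar>(w - D y w) \<bullet> D y w'\<bar> \<le> height y / \<tau> * norm (D y w) * norm (D y w')"
proof -
  define b where "b w w' = (w - D y w) \<bullet> D y w'" for w w'
  define \<kappa> where "\<kappa> = height y / \<tau>"
  note lin = linear_add[OF linear_D[OF y]] linear_diff[OF linear_D[OF y]] linear_scale[OF linear_D[OF y]]
  have sym: "b w w' = b w' w" for w w'
    using D_symmetric[OF y, of w' w] unfolding b_def inner_diff_left
    by (simp add: inner_commute[of w] inner_commute[of w'] inner_commute[of "D y w'" "D y w"])
  have main: "b w w' \<le> \<kappa> * norm (D y w) * norm (D y w')" for w w'
  proof (cases "D y w = 0 \<or> D y w' = 0")
    case True
    then show ?thesis using sym[of w w'] by (auto simp: b_def)
  next
    case False
    \<comment> \<open>Scaling by \<open>l\<close> makes \<open>D y w\<close> and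
      \<open>l *\<^sub>R D y w'\<close> equally long, so that polarization and the parallelogram law
      produce the product of the norms instead of a sum of squares.\<close>
    define l where "l = norm (D y w) / norm (D y w')"
    have l: "l > 0" "l * norm (D y w') = norm (D y w)" using False by (auto simp: l_def)
    have "4 * l * b w w' = b (w + l *\<^sub>R w') (w + l *\<^sub>R w') - b (w - l *\<^sub>R w') (w - l *\<^sub>R w')"
      using sym[of w w'] unfolding b_def lin
      by (simp add: inner_add inner_diff algebra_simps inner_commute[of "D y w'" "D y w"])
    also have "\<dots> \<le> \<kappa> * norm (D y (w + l *\<^sub>R w')) ^ 2 + \<kappa> * norm (D y (w - l *\<^sub>R w')) ^ 2"
      using D_inner_self[OF y, of "w + l *\<^sub>R w'"] D_inner_self[OF y, of "w - l *\<^sub>R w'"]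
      by (simp add: b_def \<kappa>_def abs_le_iff)
    also have "\<dots> = 2 * \<kappa> * (norm (D y w) ^ 2 + (l * norm (D y w')) ^ 2)"
      unfolding lin power2_norm_eq_inner power_mult_distrib
      by (simp add: inner_add inner_diff inner_commute algebra_simps power2_eq_square)
    also have "\<dots> = 4 * l * (\<kappa> * norm (D y w) * norm (D y w'))"
      unfolding l(2)[symmetric] by (simp add: power2_eq_square algebra_simps)
    finally show ?thesis using l(1) by simp
  qed
  have "b w (- w') = - b w w'" using lin by (simp add: b_def linear_neg[OF linear_D[OF y]])
  with main[of w w'] main[of w "- w'"] show ?thesis
    by (simp add: abs_le_iff b_def \<kappa>_def linear_neg[OF linear_D[OF y]])
qed

lemma D_norm_le:
  assumes y: "y \<in> tube" shows "(1 - height y / \<tau>) * norm (D y w) \<le> norm w"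
proof (cases "D y w = 0")
  case False
  have "norm (D y w) * ((1 - height y / \<tau>) * norm (D y w)) \<le> w \<bullet> D y w"
    using D_inner_self[OF y, of w]
    by (simp add: abs_le_iff inner_diff_left algebra_simps power2_eq_square flip: power2_norm_eq_inner)
  also have "\<dots> \<le> norm (D y w) * norm w" using norm_cauchy_schwarz[of w "D y w"] by (simp add: mult.commute)
  finally show ?thesis using False by (simp only: mult_le_cancel_left) auto
qed simp

section \<open>On \<open>M\<close> the derivative is the orthogonal projection to the tangent
  space\<close>

lemma D_idem: "m \<in> M \<Longrightarrow> D m (D m w) = D m w"
  using D_P_D[of m w] by (simp add: M_tube P_self)

lemma D_inner_D: "m \<in> M \<Longrightarrow> D m a \<bullet> D m b = D m a \<bullet> b"
  using D_symmetric[OF M_tube, of m "D m a" b] D_symmetric[OF M_tube, of m b "D m a"]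
  by (simp add: D_idem inner_commute)

lemma D_pythagoras: "m \<in> M \<Longrightarrow> norm w ^ 2 = norm (D m w) ^ 2 + norm (w - D m w) ^ 2"
  using D_inner_D[of m w w]
  by (simp add: power2_norm_eq_inner inner_diff inner_commute)

lemma D_contraction: "m \<in> M \<Longrightarrow> norm (D m w) \<le> norm w"
  and D_co_contraction: "m \<in> M \<Longrightarrow> norm (w - D m w) \<le> norm w"
  using D_pythagoras[of m w] by (auto intro: power2_le_imp_le)

text \<open>Along a short normal segment \<open>P\<close> is constant, so \<open>D m\<close> kills
  normal vectors. Conversely \<open>D m\<close> fixes velocities of curves in \<open>M\<close>, and
  symmetry makes its kernel orthogonal to them. Normality can henceforth be tested by a linear
  equation.\<close>

lemma normal_iff:
  assumes "m \<in> M" shows "v \<in> normal_space M m \<longleftrightarrow> D m v = 0"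
proof
  assume v: "v \<in> normal_space M m"
  have "\<forall>\<^sub>F t in nhds (0::real). norm (t *\<^sub>R v) < \<tau>"
  proof -
    have "((\<lambda>t::real. norm (t *\<^sub>R v)) \<longlongrightarrow> norm (0 *\<^sub>R v)) (nhds 0)"
      by (intro tendsto_intros filterlim_ident)
    then show ?thesis by (rule order_tendstoD(2)) (simp add: \<tau>_pos)
  qed
  then have "\<forall>\<^sub>F t in at 0. P (m + t *\<^sub>R v) = m"
    unfolding eventually_nhds_conv_at using P_add_normal[OF assms] v subspace_normal
    by (auto elim!: eventually_mono simp: subspace_mul)
  from has_derivative_transform_eventually[OF D_line[OF M_tube[OF assms], of v, unfolded has_vector_derivative_def] this]
  have "((\<lambda>t::real. m) has_vector_derivative D m v) (at 0)"
    by (simp add: P_self assms has_vector_derivative_def)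
  then show "D m v = 0" using vector_derivative_unique_at has_vector_derivative_const by blast
next
  assume 0: "D m v = 0"
  show "v \<in> normal_space M m"
    unfolding normal_space_def orthogonal_comp_def orthogonal_def
  proof safe
    fix w assume "w \<in> tangent_space M m"
    then obtain \<gamma> e where *: "0 < e" "\<gamma> ` {-e<..<e} \<subseteq> M" "\<gamma> 0 = m"
      "(\<gamma> has_vector_derivative w) (at (0::real))"
      unfolding tangent_space_def by blast
    have "\<forall>\<^sub>F t in nhds 0. \<gamma> t \<in> M"
      unfolding eventually_nhds_metric using *(1,2)
      by (intro exI[of _ e]) (auto simp: image_subset_iff abs_less_iff)
    from D_curve[OF *(4) this] have "D m w = w" by (simp add: *(3))
    then show "w \<bullet> v = 0" using D_symmetric[OF M_tube[OF assms], of w v] 0 by simp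
  qed
qed

section \<open>Qualitative continuity of the tangent spaces\<close>

text \<open>The curve \<open>h (P (x + t *\<^sub>R w))\<close> stays in the closed subspace
  \<open>S\<close>, hence so does its velocity. Together with \<open>D_g'_slice\<close> this
  identifies the range of \<open>D x\<close> with the image of \<open>S\<close> under
  \<open>g' (h x)\<close>.\<close>

lemma h'_D_in_slice:
  assumes "slice_chart M U V S h g h' g'" "x \<in> M" "x \<in> U"
  shows "h' x (D x w) \<in> S"
proof -
  interpret slice_chart M U V S h g h' g' by fact
  have x: "x \<in> tube" "P x = x" using assms(2) by (auto simp: M_tube P_self)
  have "((\<lambda>t. P (x + t *\<^sub>R w)) has_derivative (\<lambda>t. t *\<^sub>R D x w)) (at 0)"
    using D_line[OF x(1)] by (simp add: has_vector_derivative_def)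
  moreover have "(h has_derivative h' x) (at (P (x + 0 *\<^sub>R w)))"
    using h'[OF assms(3)] x(2) by simp
  ultimately have "((\<lambda>t. h (P (x + t *\<^sub>R w))) has_derivative (\<lambda>t. h' x (t *\<^sub>R D x w))) (at 0)"
    by (rule has_derivative_compose)
  then have "((\<lambda>t. h (P (x + t *\<^sub>R w))) has_vector_derivative h' x (D x w)) (at 0)"
    using has_derivative_linear[OF h'[OF assms(3)]] by (simp add: has_vector_derivative_def linear_scale)
  from difference_quotient_tendsto[OF this]
  have lim: "((\<lambda>t. (h (P (x + t *\<^sub>R w)) - h x) /\<^sub>R t) \<longlongrightarrow> h' x (D x w)) (at 0)"
    by (simp add: x)
  have "\<forall>\<^sub>F t in at (0::real). P (x + t *\<^sub>R w) \<in> U"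
  proof -
    have "((\<lambda>t. x + t *\<^sub>R w) \<longlongrightarrow> x + 0 *\<^sub>R w) (at 0)" by (intro tendsto_intros)
    then have "filterlim (\<lambda>t. x + t *\<^sub>R w) (nhds x) (at 0)" by simp
    then show ?thesis
      using P_eventually_in_U[OF x(1) open_U] assms(3) x(2) by (auto simp: filterlim_iff)
  qed
  then have "\<forall>\<^sub>F t in at 0. (h (P (x + t *\<^sub>R w)) - h x) /\<^sub>R t \<in> S"
  proof eventually_elim
    case (elim t)
    have "h (P (x + t *\<^sub>R w)) \<in> S" "h x \<in> S" using slice elim P_in assms(2,3) by blast+
    then show ?case using subspace_S by (simp add: subspace_mul subspace_diff)
  qed
  with lim show ?thesis
    by (intro Lim_in_closed_set[OF closed_subspace[OF subspace_S]]) auto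
qed

lemma D_g'_slice:
  assumes "slice_chart M U V S h g h' g'" "s \<in> V" "s \<in> S" "e \<in> S"
  shows "D (g s) (g' s e) = g' s e"
proof -
  interpret slice_chart M U V S h g h' g' by fact
  from D_curve[OF slice_curve_derivative[OF assms(2)] slice_curve_in_M[OF assms(2-4)]]
  show ?thesis by simp
qed

text \<open>The chart transports the tangent vector \<open>w = D x v\<close> to a tangent vector
  \<open>w'\<close> at \<open>x'\<close>, which is orthogonal to \<open>v\<close>. So
  \<open>norm w ^ 2 = v \<bullet> (w - w')\<close>, and \<open>w - w'\<close> is of order
  \<open>norm (x - x') * norm w\<close>. The constant depends on the chart and only serves to
  control errors.\<close>

lemma D_normal_locally_lipschitz:
  assumes q: "q \<in> M"
  obtains C d where "0 \<le> C" "0 < d"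
    "\<And>x x' v. x \<in> M \<Longrightarrow> x' \<in> M \<Longrightarrow> dist x q < d \<Longrightarrow> dist x' q < d \<Longrightarrow> D x' v = 0 \<Longrightarrow>
      norm (D x v) \<le> C * norm (x - x') * norm v"
proof -
  obtain U V S h g h' g' where chart: "slice_chart M U V S h g h' g'" and qU: "q \<in> U"
    using slice_chart_exists[OF smooth q] by blast
  interpret slice_chart M U V S h g h' g' by fact
  obtain Ch dh where Ch: "0 \<le> Ch" "0 < dh" "cball q dh \<subseteq> U"
    "\<And>u v. u \<in> cball q dh \<Longrightarrow> v \<in> cball q dh \<Longrightarrow> norm (h u - h v) \<le> Ch * norm (u - v)"
    using Ck_on_1_locally_lipschitz[OF open_U h_C1 qU] by metis
  have "\<exists>C d. 0 \<le> C \<and> 0 < d \<and> cball (h q) d \<subseteq> V \<and>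
      (\<forall>u\<in>cball (h q) d. \<forall>v\<in>cball (h q) d. norm (g' u b - g' v b) \<le> C * norm (u - v))" for b
    using Ck_on_1_locally_lipschitz[OF open_V g'_C1[of b] h_in[OF qU]] by metis
  then obtain Cg dg where Cg: "\<And>b. 0 \<le> Cg b" "\<And>b. 0 < dg b" "\<And>b. cball (h q) (dg b) \<subseteq> V"
    "\<And>b u v. u \<in> cball (h q) (dg b) \<Longrightarrow> v \<in> cball (h q) (dg b) \<Longrightarrow>
      norm (g' u b - g' v b) \<le> Cg b * norm (u - v)"
    by metis
  define d0 where "d0 = Min (dg ` Basis)"
  have d0: "0 < d0" "\<And>b. b \<in> Basis \<Longrightarrow> d0 \<le> dg b" unfolding d0_def using Cg(2) by auto
  define C0 where "C0 = (\<Sum>b\<in>Basis. Cg b)"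
  have C0: "0 \<le> C0" unfolding C0_def by (intro sum_nonneg Cg)
  have lip: "norm (g' u e - g' v e) \<le> C0 * norm (u - v) * norm e"
    if uv: "u \<in> cball (h q) d0" "v \<in> cball (h q) d0" "u \<in> V" "v \<in> V" for u v e
  proof -
    have "bounded_linear (\<lambda>e. g' u e - g' v e)"
      by (intro bounded_linear_sub linear_conv_bounded_linear[THEN iffD1] linear_g' uv)
    then have a: "norm (g' u e - g' v e) \<le> onorm (\<lambda>e. g' u e - g' v e) * norm e"
      and b: "onorm (\<lambda>e. g' u e - g' v e) \<le> (\<Sum>b\<in>Basis. norm (g' u b - g' v b))"
      by (rule onorm, rule onorm_componentwise)
    note b
    also have "(\<Sum>b\<in>Basis. norm (g' u b - g' v b)) \<le> C0 * norm (u - v)"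
      unfolding C0_def sum_distrib_right
    proof (rule sum_mono)
      fix b :: 'a assume "b \<in> Basis"
      then have "u \<in> cball (h q) (dg b)" "v \<in> cball (h q) (dg b)"
        using uv(1,2) d0(2)[of b] by auto
      then show "norm (g' u b - g' v b) \<le> Cg b * norm (u - v)" by (rule Cg(4))
    qed
    finally have "onorm (\<lambda>e. g' u e - g' v e) * norm e \<le> C0 * norm (u - v) * norm e"
      by (rule mult_right_mono) simp
    with a show ?thesis by (rule order_trans)
  qed
  define d where "d = min dh (d0 / (Ch + 1))"
  show ?thesis
  proof (rule that)
    show "0 \<le> C0 * Ch * Ch" using C0 Ch by simp
    show "0 < d" using Ch d0(1) by (simp add: d_def)
    fix x x' v assume x: "x \<in> M" "x' \<in> M" "dist x q < d" "dist x' q < d" and v: "D x' v = 0"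
    have near: "u \<in> U \<and> h u \<in> cball (h q) d0 \<and> u \<in> cball q dh" if "dist u q < d" for u
    proof -
      have u: "u \<in> cball q dh" using that by (auto simp: d_def dist_commute)
      have "norm (h u - h q) \<le> Ch * norm (u - q)" using u Ch(2) by (intro Ch(4)) auto
      also have "\<dots> \<le> (Ch + 1) * norm (u - q)" by (simp add: algebra_simps)
      also have "\<dots> \<le> (Ch + 1) * (d0 / (Ch + 1))"
        using that Ch(1) by (intro mult_left_mono) (auto simp: d_def dist_norm)
      also have "\<dots> = d0" using Ch(1) by simp
      finally show ?thesis using u Ch(3) by (auto simp: dist_norm norm_minus_commute)
    qed
    note nx = near[OF x(3)] and nx' = near[OF x(4)]
    have h'_le: "norm (h' x w) \<le> Ch * norm w" for w
    proof (rule tendsto_upperbound)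
      have "(h has_derivative h' x) (at (x + 0 *\<^sub>R w))" using h' nx by simp
      from tendsto_norm[OF difference_quotient_tendsto[OF has_derivative_line[OF this]]]
      show "((\<lambda>t. norm ((h (x + t *\<^sub>R w) - h x) /\<^sub>R t)) \<longlongrightarrow> norm (h' x w)) (at 0)" by simp
      have "((\<lambda>t. x + t *\<^sub>R w) \<longlongrightarrow> x + 0 *\<^sub>R w) (at 0)" by (intro tendsto_intros)
      moreover have "x + 0 *\<^sub>R w \<in> ball q dh" using x(3) by (simp add: d_def dist_commute)
      ultimately have "\<forall>\<^sub>F t in at 0. x + t *\<^sub>R w \<in> ball q dh"
        by (intro topological_tendstoD) auto
      moreover have "\<forall>\<^sub>F t::real in at 0. t \<noteq> 0" by (simp add: eventually_at_filter)
      ultimately show "\<forall>\<^sub>F t in at 0. norm ((h (x + t *\<^sub>R w) - h x) /\<^sub>R t) \<le> Ch * norm w"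
      proof eventually_elim
        case (elim t)
        then have "norm (h (x + t *\<^sub>R w) - h x) \<le> Ch * norm (x + t *\<^sub>R w - x)"
          using nx by (intro Ch(4)) auto
        then show ?case
          using elim(2) by (simp add: pos_divide_le_eq mult_ac flip: divide_inverse_commute)
      qed
    qed simp
    define w where "w = D x v"
    define s where "s = h' x w"
    define w' where "w' = g' (h x') s"
    have sS: "s \<in> S" unfolding s_def w_def using h'_D_in_slice[OF chart x(1)] nx by blast
    have ws: "w = g' (h x) s" unfolding s_def using g'_h'[of x] nx by simp
    have "h x' \<in> S" using slice x(2) nx' by blast
    from D_g'_slice[OF chart _ this sS] have "D x' w' = w'" using nx' h_in g_h by (simp add: w'_def)
    then have "v \<bullet> w' = 0"
      using D_symmetric[OF M_tube[OF x(2)], of v w'] v by (simp add: inner_commute)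
    then have "norm w ^ 2 = v \<bullet> (w - w')"
      using D_inner_D[OF x(1), of v v] by (simp add: w_def power2_norm_eq_inner inner_diff_right inner_commute)
    also have "\<dots> \<le> norm v * norm (w - w')" by (rule norm_cauchy_schwarz)
    also have "\<dots> \<le> norm v * (C0 * (Ch * norm (x - x')) * (Ch * norm w))"
    proof (rule mult_left_mono)
      have "norm (w - w') \<le> C0 * norm (h x - h x') * norm s"
        unfolding ws w'_def using nx nx' h_in by (intro lip) auto
      also have "\<dots> \<le> C0 * (Ch * norm (x - x')) * (Ch * norm w)"
        using nx nx' C0 Ch h'_le[of w] by (intro mult_mono Ch(4)) (auto simp: s_def)
      finally show "norm (w - w') \<le> C0 * (Ch * norm (x - x')) * (Ch * norm w)" .
    qed simp
    finally have "norm w * norm w \<le> norm w * (C0 * Ch * Ch * norm (x - x') * norm v)"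
      by (simp add: power2_eq_square mult_ac)
    then show "norm (D x v) \<le> C0 * Ch * Ch * norm (x - x') * norm v"
      using C0 Ch by (cases "w = 0") (auto simp: w_def)
  qed
qed

text \<open>The difference is \<open>D x (u - D x' u)\<close> minus
  \<open>D x' u - D x (D x' u)\<close>. The first term is \<open>D x\<close> of a vector normal at
  \<open>x'\<close>; the second is, by symmetry, the adjoint of the first with \<open>x\<close> and
  \<open>x'\<close> exchanged. Each contributes one \<open>C\<close>.\<close>

lemma D_locally_lipschitz:
  assumes x: "x \<in> M" "x' \<in> M" and C: "0 \<le> C"
    and lip: "\<And>v. D x' v = 0 \<Longrightarrow> norm (D x v) \<le> C * norm v"
      "\<And>v. D x v = 0 \<Longrightarrow> norm (D x' v) \<le> C * norm v"
  shows "norm (D x u - D x' u) \<le> 2 * C * norm u"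
proof -
  note lin = linear_diff[OF linear_D[OF M_tube[OF x(1)]]] linear_diff[OF linear_D[OF M_tube[OF x(2)]]]
  have "norm (D x (u - D x' u)) \<le> C * norm (u - D x' u)"
    by (intro lip) (simp add: lin D_idem x)
  also have "\<dots> \<le> C * norm u" using D_co_contraction[OF x(2)] C by (intro mult_left_mono)
  finally have 1: "norm (D x (u - D x' u)) \<le> C * norm u" .
  define n where "n = D x' u - D x (D x' u)"
  have n: "D x n = 0" by (simp add: n_def lin D_idem x)
  have "norm n ^ 2 = n \<bullet> D x' u - n \<bullet> D x (D x' u)"
    unfolding power2_norm_eq_inner by (simp add: n_def inner_diff_right)
  also have "n \<bullet> D x (D x' u) = 0"
    using D_symmetric[OF M_tube[OF x(1)], of n "D x' u"] n by (simp add: inner_commute)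
  also have "n \<bullet> D x' u - 0 = D x' n \<bullet> u"
    using D_symmetric[OF M_tube[OF x(2)], of n u] by (simp add: inner_commute)
  also have "\<dots> \<le> norm (D x' n) * norm u" by (rule norm_cauchy_schwarz)
  also have "\<dots> \<le> (C * norm n) * norm u" using lip(2)[OF n] by (intro mult_right_mono) auto
  finally have "norm n * norm n \<le> norm n * (C * norm u)" by (simp add: power2_eq_square mult_ac)
  then have 2: "norm n \<le> C * norm u" using C by (cases "n = 0") auto
  have "D x u - D x' u = D x (u - D x' u) - n" by (simp add: n_def lin)
  then have "norm (D x u - D x' u) \<le> norm (D x (u - D x' u)) + norm n"
    by (simp only: norm_triangle_ineq4)
  with 1 2 show ?thesis by simp
qed

section \<open>Comparison of \<open>D y\<close> with \<open>D (P y)\<close>\<close>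

text \<open>Removing the part of \<open>v\<close> tangent at \<open>x\<close> supplies test points
  whose foot point is prescribed.\<close>

lemma D_lift_normal:
  assumes "x \<in> M" "norm v < \<tau>"
  shows "P (x + (v - D x v)) = x"
proof (rule P_add_normal[OF assms(1)])
  show "v - D x v \<in> normal_space M x"
    by (simp add: normal_iff assms(1) D_idem linear_diff[OF linear_D[OF M_tube[OF assms(1)]]])
  show "norm (v - D x v) < \<tau>" using D_co_contraction[OF assms(1), of v] assms(2) by simp
qed

text \<open>
  Sliding the normal vector \<open>v\<close> along \<open>M\<close> moves the foot point \<open>q\<close> in every tangent direction, so \<open>D (q + v)\<close>
  still has the whole tangent space as its range.
\<close>

lemma range_D_subset:
  assumes q: "q \<in> M" and v: "D q v = 0" "norm v < \<tau>" and t: "D q t = t"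
  obtains w where "D (q + v) w = t"
proof -
  define y where "y = q + v"
  have Py: "P y = q" and y: "y \<in> tube"
    using P_add_normal[OF q _ v(2)] height_add_normal[OF q _ v(2)] v normal_iff[OF q]
    by (auto simp: y_def tube_def)
  interpret Dy: linear "D y" by (rule linear_D[OF y])
  obtain C d where C: "0 \<le> C" "0 < d"
    "\<And>x v. x \<in> M \<Longrightarrow> dist x q < d \<Longrightarrow> D q v = 0 \<Longrightarrow> norm (D x v) \<le> C * norm (x - q) * norm v"
    using D_normal_locally_lipschitz[OF q] q by (metis dist_self)
  define x where "x s = P (q + s *\<^sub>R t)" for s :: real
  \<comment> \<open>\<open>z s\<close> lies over \<open>x s\<close>, so \<open>P (z s)\<close> moves
    with velocity \<open>t\<close> at \<open>s = 0\<close>, and expanding \<open>P\<close> at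
    \<open>y\<close> links this to \<open>D y (z s - y)\<close>.\<close>
  define z where "z s = x s + (v - D (x s) v)" for s
  have x0: "x 0 = q" by (simp add: x_def P_self q)
  have xM: "x s \<in> M" for s by (simp add: x_def P_in)
  have Pz: "P (z s) = x s" for s unfolding z_def by (rule D_lift_normal[OF xM v(2)])
  have quot: "((\<lambda>s. (x s - q) /\<^sub>R s) \<longlongrightarrow> t) (at 0)"
    using difference_quotient_tendsto[OF D_line[OF M_tube[OF q], of t]] t by (simp add: x_def P_self q)
  have "isCont x 0"
    using has_vector_derivative_continuous[OF D_line[OF M_tube[OF q], of t]] by (simp add: x_def[abs_def])
  then have xlim: "(x \<longlongrightarrow> q) (at 0)" by (simp add: isCont_def x0)
  define L where "L = 1 + C * norm v"
  have L: "L > 0" unfolding L_def using C(1) by (intro add_pos_nonneg) auto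
  have zb: "\<forall>\<^sub>F s in at 0. norm (z s - y) \<le> L * norm (x s - q)"
    using tendstoD[OF xlim C(2)]
  proof eventually_elim
    case (elim s)
    have "norm (D (x s) v) \<le> C * norm (x s - q) * norm v"
      using elim v(1) xM by (intro C(3))
    moreover have "norm (z s - y) \<le> norm (x s - q) + norm (D (x s) v)"
      using norm_triangle_ineq4[of "x s - q" "D (x s) v"] by (simp add: z_def y_def algebra_simps)
    ultimately show ?case by (simp add: L_def algebra_simps)
  qed
  have main: "((\<lambda>s. D y ((z s - y) /\<^sub>R s)) \<longlongrightarrow> t) (at 0)"
  proof (rule Lim_transform2[OF quot])
    show "((\<lambda>s. (x s - q) /\<^sub>R s - D y ((z s - y) /\<^sub>R s)) \<longlongrightarrow> 0) (at 0)"
    proof (rule tendstoI)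
      fix e :: real assume e: "e > 0"
      define c where "c = norm t + 1"
      define e' where "e' = e / (2 * L * c)"
      have nt: "c > 0" unfolding c_def by (intro add_nonneg_pos) auto
      have e': "e' > 0" using e L nt by (simp add: e'_def)
      obtain d' where d': "d' > 0" "\<And>z. norm (z - y) < d' \<Longrightarrow> norm (P z - P y - D y (z - y)) \<le> e' * norm (z - y)"
        using D[OF y] e' unfolding has_derivative_at_alt by meson
      have "\<forall>\<^sub>F s in at 0. dist (x s) q < d' / L" using tendstoD[OF xlim, of "d' / L"] d'(1) L by simp
      moreover have "\<forall>\<^sub>F s in at 0. norm ((x s - q) /\<^sub>R s) < c"
        unfolding c_def by (rule order_tendstoD(2)[OF tendsto_norm[OF quot]]) simp
      moreover have "\<forall>\<^sub>F s::real in at 0. s \<noteq> 0" by (simp add: eventually_at_filter)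
      ultimately show "\<forall>\<^sub>F s in at 0. dist ((x s - q) /\<^sub>R s - D y ((z s - y) /\<^sub>R s)) 0 < e"
        using zb
      proof eventually_elim
        case (elim s)
        have "norm (z s - y) < d'" using elim(1,4) L by (simp add: dist_norm field_simps)
        then have "norm (x s - q - D y (z s - y)) \<le> e' * norm (z s - y)"
          using d'(2)[of "z s"] by (simp add: Pz Py)
        also have "\<dots> \<le> e' * (L * norm (x s - q))" using elim(4) e' by (intro mult_left_mono) auto
        finally have le: "norm (x s - q - D y (z s - y)) \<le> e' * (L * norm (x s - q))" .
        have "norm ((x s - q) /\<^sub>R s - D y ((z s - y) /\<^sub>R s)) = norm (x s - q - D y (z s - y)) / \<bar>s\<bar>"
          by (simp add: Dy.scale divide_inverse mult.commute flip: scaleR_right_diff_distrib)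
        also have "\<dots> \<le> e' * (L * norm (x s - q)) / \<bar>s\<bar>" using le by (rule divide_right_mono) simp
        also have "\<dots> = e' * L * norm ((x s - q) /\<^sub>R s)" by (simp add: divide_inverse mult_ac)
        also have "\<dots> \<le> e' * L * c" using elim(2) e' L by (intro mult_left_mono) auto
        also have "\<dots> = e / 2" using L nt by (simp add: e'_def)
        also have "\<dots> < e" using e by simp
        finally show ?case by simp
      qed
    qed
  qed
  \<comment> \<open>The quotients \<open>(z s - y) /\<^sub>R s\<close> need not be known to
    converge: their images under \<open>D y\<close> do, and the range of \<open>D y\<close> is a
    closed subspace.\<close>
  have "t \<in> range (D y)"
    by (rule Lim_in_closed_set[OF closed_subspace _ _ main])
      (auto intro: linear_subspace_image linear_D[OF y])
  with that show ?thesis unfolding y_def by blast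
qed

lemma P_normal_0: "D (P y) (y - P y) = 0"
  using P_normal normal_iff[OF P_in] by blast

text \<open>The difference \<open>t\<close> is tangent at \<open>P y\<close>, so
  \<open>range_D_subset\<close> writes it as \<open>D y w\<close>. Then
  \<open>norm t ^ 2 = (u - D y u) \<bullet> D y w\<close>, where the off-diagonal bound
  \<open>D_inner\<close> applies, and \<open>D_norm_le\<close> replaces \<open>D y u\<close> by
  \<open>u\<close>.\<close>

lemma D_off_M:
  assumes y: "y \<in> tube"
  shows "(\<tau> - height y) * norm (D y u - D (P y) u) \<le> height y * norm u"
proof -
  define t where "t = D (P y) (u - D y u)"
  have t: "t = D (P y) u - D y u"
    by (simp add: t_def linear_diff[OF linear_D[OF M_tube[OF P_in]]] D_P_D[OF y])
  have "D (P y) t = t" by (simp add: t_def D_idem P_in)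
  moreover have "norm (y - P y) < \<tau>" using y by (simp add: tube_def height_def)
  ultimately obtain w where w: "D y w = t"
    using range_D_subset[OF P_in P_normal_0, of y t] by auto
  have "norm t ^ 2 = (u - D y u) \<bullet> t"
    using D_inner_D[OF P_in, of y "u - D y u" "u - D y u"]
    by (simp add: t_def power2_norm_eq_inner inner_commute)
  also have "\<dots> \<le> height y / \<tau> * norm (D y u) * norm t"
    using D_inner[OF y, of u w] w by (simp add: abs_le_iff)
  finally have "norm t * norm t \<le> norm t * (height y / \<tau> * norm (D y u))"
    by (simp add: power2_eq_square mult_ac)
  then have 1: "norm t \<le> height y / \<tau> * norm (D y u)"
  proof (cases "t = 0")
    case False
    then have "0 < norm t" by simp
    then show ?thesis
      using \<open>norm t * norm t \<le> norm t * (height y / \<tau> * norm (D y u))\<close> by (rule mult_left_le_imp_le[rotated])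
  qed (use height_nonneg[of y] \<tau>_pos in auto)
  have "(1 - height y / \<tau>) * norm t \<le> (1 - height y / \<tau>) * (height y / \<tau> * norm (D y u))"
    using 1 y \<tau>_pos by (intro mult_left_mono) (auto simp: tube_def)
  also have "\<dots> = height y / \<tau> * ((1 - height y / \<tau>) * norm (D y u))" by simp
  also have "\<dots> \<le> height y / \<tau> * norm u"
    using D_norm_le[OF y, of u] height_nonneg[of y] \<tau>_pos by (intro mult_left_mono) auto
  finally have "(1 - height y / \<tau>) * norm t \<le> height y / \<tau> * norm u" .
  then have "\<tau> * ((1 - height y / \<tau>) * norm t) \<le> \<tau> * (height y / \<tau> * norm u)"
    using \<tau>_pos by (intro mult_left_mono) auto
  moreover have "\<tau> * ((1 - height y / \<tau>) * norm t) = (\<tau> - height y) * norm t"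
    using \<tau>_pos by (simp add: field_simps)
  moreover have "\<tau> * (height y / \<tau> * norm u) = height y * norm u" using \<tau>_pos by simp
  ultimately have "(\<tau> - height y) * norm t \<le> height y * norm u" by (simp only:)
  then show ?thesis by (simp only: t norm_minus_commute)
qed

end

section \<open>Variation of the tangent spaces\<close>

text \<open>Hypothesis \<open>a\<close> comes from \<open>foot_points_distance\<close>. After
  squaring, the claim follows from an inequality affine in \<tau> with nonnegative slope
  \<open>5 * r ^ 2 - 6 * r * d + 5 * d ^ 2\<close>, so it suffices to treat
  \<open>\<tau> = 2 * r\<close>, where it is a cubic in \<open>r\<close> and
  \<open>d\<close>.\<close>

lemma foot_distance_arith:
  fixes a d r \<tau> :: real
  assumes "0 \<le> d" "d \<le> r" "2 * r < \<tau>" "0 \<le> a" and a: "a ^ 2 * (\<tau> - d) \<le> \<tau> * (r ^ 2 - d ^ 2)"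
  shows "2 * a \<le> 3 * r - d"
proof (rule power2_le_imp_le)
  have "(2 * a) ^ 2 * (\<tau> - d) \<le> 4 * (\<tau> * (r ^ 2 - d ^ 2))" using a by (simp add: power_mult_distrib)
  also have "\<dots> \<le> (3 * r - d) ^ 2 * (\<tau> - d)"
  proof -
    have q: "0 \<le> 5 * r ^ 2 - 6 * r * d + 5 * d ^ 2"
    proof -
      have "5 * r ^ 2 - 6 * r * d + 5 * d ^ 2 = 2 * r ^ 2 + 2 * d ^ 2 + 3 * (r - d) ^ 2"
        by (simp add: power2_eq_square algebra_simps)
      also have "\<dots> \<ge> 0" by simp
      finally show ?thesis .
    qed
    have "0 \<le> r * (10 * r ^ 2 - 21 * r * d + 15 * d ^ 2) + d ^ 2 * (r - d)"
    proof -
      \<comment> \<open>Completing the square; the discriminant \<open>441 - 600\<close> is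
        negative.\<close>
      have "10 * r ^ 2 - 21 * r * d + 15 * d ^ 2 = 10 * (r - 21 / 20 * d) ^ 2 + (15 - 441 / 40) * d ^ 2"
        by (simp add: power2_eq_square algebra_simps)
      also have "\<dots> \<ge> 0" by simp
      finally have "0 \<le> 10 * r ^ 2 - 21 * r * d + 15 * d ^ 2" .
      then have "0 \<le> r * (10 * r ^ 2 - 21 * r * d + 15 * d ^ 2)"
        using assms by (intro mult_nonneg_nonneg) auto
      moreover have "0 \<le> d ^ 2 * (r - d)" using assms by simp
      ultimately show ?thesis by linarith
    qed
    also have "\<dots> = 2 * r * (5 * r ^ 2 - 6 * r * d + 5 * d ^ 2) - d * (3 * r - d) ^ 2"
      by (simp add: power2_eq_square algebra_simps)
    also have "\<dots> \<le> \<tau> * (5 * r ^ 2 - 6 * r * d + 5 * d ^ 2) - d * (3 * r - d) ^ 2"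
      using q assms(3) by (intro diff_right_mono mult_right_mono) auto
    also have "\<dots> = (3 * r - d) ^ 2 * (\<tau> - d) - 4 * (\<tau> * (r ^ 2 - d ^ 2))"
      by (simp add: power2_eq_square algebra_simps)
    finally show ?thesis by simp
  qed
  finally show "(2 * a) ^ 2 \<le> (3 * r - d) ^ 2" using assms by (simp add: mult_le_cancel_right)
qed (use assms in simp)

context smooth_positive_reach
begin

text \<open>
  Pointwise form of the bound \<open>1 / \<tau>\<close> on the second fundamental form. The point \<open>x + (v - D x v)\<close> projects
  to \<open>x\<close>; comparing this with the derivative \<open>D y\<close> at \<open>y = q + v\<close> determines \<open>D x v\<close> to first order.
\<close>

lemma D_normal_first_order_short:
  assumes q: "q \<in> M" and v: "D q v = 0" "norm v < \<tau>" and e: "e > 0"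
  shows "\<forall>\<^sub>F x in nhds q. x \<in> M \<longrightarrow> norm (D q (D x v)) \<le> (norm v / \<tau> + e) * norm (x - q)"
proof -
  define y where "y = q + v"
  define \<kappa> where "\<kappa> = norm v / \<tau>"
  have \<kappa>: "0 \<le> \<kappa>" "\<kappa> < 1" using v(2) \<tau>_pos by (auto simp: \<kappa>_def)
  have Py: "P y = q" and hy: "height y = norm v" and y: "y \<in> tube"
    using P_add_normal[OF q _ v(2)] height_add_normal[OF q _ v(2)] v normal_iff[OF q]
    by (auto simp: y_def tube_def)
  note linq = linear_D[OF M_tube[OF q]]
  obtain C d where C: "0 \<le> C" "0 < d"
    "\<And>x v. x \<in> M \<Longrightarrow> dist x q < d \<Longrightarrow> D q v = 0 \<Longrightarrow> norm (D x v) \<le> C * norm (x - q) * norm v"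
    using D_normal_locally_lipschitz[OF q] q by (metis dist_self)
  define L where "L = 1 + C * norm v"
  have L: "L > 0" unfolding L_def using C(1) by (intro add_pos_nonneg) auto
  define e' where "e' = e / (2 * L)"
  have e': "e' > 0" "2 * (e' * L) = e" using e L by (auto simp: e'_def)
  obtain d' where d': "d' > 0" "\<And>z. norm (z - y) < d' \<Longrightarrow> norm (P z - P y - D y (z - y)) \<le> e' * norm (z - y)"
    using D[OF y] e' unfolding has_derivative_at_alt by meson
  show ?thesis
    unfolding eventually_nhds_metric
  proof (intro exI conjI allI impI)
    show "0 < min d (d' / L)" using C(2) d'(1) L by simp
    fix x assume "dist x q < min d (d' / L)" and x: "x \<in> M"
    then have dx: "dist x q < d" "L * norm (x - q) < d'" using L by (auto simp: dist_norm field_simps)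
    define a where "a = x - q"
    define z where "z = x + (v - D x v)"
    have Pz: "P z = x" unfolding z_def by (rule D_lift_normal[OF x v(2)])
    have zy: "z - y = a - D x v" by (simp add: z_def y_def a_def)
    have "norm (z - y) \<le> norm a + norm (D x v)" unfolding zy by (rule norm_triangle_ineq4)
    also have "\<dots> \<le> L * norm a" using C(3)[OF x dx(1) v(1)] by (simp add: L_def a_def algebra_simps)
    finally have zL: "norm (z - y) \<le> L * norm a" .
    define w where "w = D y (z - y)"
    define r where "r = a - w"
    have "norm r \<le> e' * norm (z - y)"
      using d'(2)[of z] zL dx(2) by (simp add: Pz Py r_def w_def a_def)
    also have "\<dots> \<le> e' * (L * norm a)" using zL e'(1) by (intro mult_left_mono) auto
    finally have r: "2 * norm r \<le> e * norm a" using e'(2) by (simp add: mult.assoc flip: e'(2))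
    define t where "t = D q (D x v)"
    obtain w' where w': "D y w' = t"
      using range_D_subset[OF q v, of t] by (auto simp: t_def D_idem q y_def)
    have "norm t ^ 2 = D x v \<bullet> t"
      using D_inner_D[OF q, of "D x v" "D x v"] by (simp add: t_def power2_norm_eq_inner inner_commute)
    \<comment> \<open>\<open>D x v\<close> is the remainder \<open>r\<close> minus
      \<open>z - y - D y (z - y)\<close>. Since \<open>t\<close> is a value of \<open>D y\<close>,
      the product of the latter with \<open>t\<close> falls under \<open>D_inner\<close>.\<close>
    also have "\<dots> = r \<bullet> t - (z - y - w) \<bullet> t" by (simp add: zy r_def inner_diff_left)
    also have "\<dots> \<le> norm r * norm t + \<kappa> * norm w * norm t"
      using norm_cauchy_schwarz[of r t] D_inner[OF y, of "z - y" w']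
      by (simp add: w' hy \<kappa>_def w_def abs_le_iff)
    finally have "norm t * norm t \<le> norm t * (norm r + \<kappa> * norm w)"
      by (simp add: power2_eq_square algebra_simps)
    then have 1: "norm t \<le> norm r + \<kappa> * norm w"
    proof (cases "t = 0")
      case False
      then have "0 < norm t" by simp
      then show ?thesis
        using \<open>norm t * norm t \<le> norm t * (norm r + \<kappa> * norm w)\<close> by (rule mult_left_le_imp_le[rotated])
    qed (use \<kappa> in auto)
    have "norm w \<le> norm a + norm r" using norm_triangle_ineq4[of a r] by (simp add: r_def)
    then have "\<kappa> * norm w \<le> \<kappa> * (norm a + norm r)" using \<kappa>(1) by (rule mult_left_mono)
    moreover have "\<kappa> * norm r \<le> norm r" using \<kappa> mult_right_mono[of \<kappa> 1 "norm r"] by simp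
    ultimately have "norm t \<le> \<kappa> * norm a + 2 * norm r" using 1 by (simp add: algebra_simps)
    with r show "norm (D q (D x v)) \<le> (norm v / \<tau> + e) * norm (x - q)"
      by (simp add: t_def \<kappa>_def a_def algebra_simps)
  qed
qed

text \<open>Both sides scale linearly when \<open>v\<close> and \<open>e\<close> are multiplied by
  \<open>c\<close>, so a short multiple of \<open>v\<close> suffices.\<close>

lemma D_normal_first_order:
  assumes q: "q \<in> M" and v: "D q v = 0" and e: "e > 0"
  shows "\<forall>\<^sub>F x in nhds q. x \<in> M \<longrightarrow> norm (D q (D x v)) \<le> (norm v / \<tau> + e) * norm (x - q)"
proof -
  define l where "l = norm v + 1"
  define c where "c = \<tau> / (2 * l)"
  have nv: "l > 0" unfolding l_def by (intro add_nonneg_pos) auto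
  then have c: "c > 0" using \<tau>_pos by (simp add: c_def)
  have "norm (c *\<^sub>R v) = c * norm v" using c by simp
  also have "\<dots> < \<tau>"
  proof -
    have "c * norm v \<le> c * l" using c by (simp add: l_def)
    also have "\<dots> = \<tau> / 2" using nv by (simp add: c_def)
    finally show ?thesis using \<tau>_pos by simp
  qed
  finally have cv: "norm (c *\<^sub>R v) < \<tau>" .
  have "D q (c *\<^sub>R v) = 0" using v by (simp add: linear_scale[OF linear_D[OF M_tube[OF q]]])
  from D_normal_first_order_short[OF q this cv, of "c * e"]
  have "\<forall>\<^sub>F x in nhds q. x \<in> M \<longrightarrow>
      norm (D q (D x (c *\<^sub>R v))) \<le> (norm (c *\<^sub>R v) / \<tau> + c * e) * norm (x - q)"
    using c e by simp
  then show ?thesis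
  proof eventually_elim
    case (elim x)
    show ?case
    proof
      assume x: "x \<in> M"
      have "c * norm (D q (D x v)) \<le> (norm (c *\<^sub>R v) / \<tau> + c * e) * norm (x - q)"
        using elim x c by (simp add: linear_scale[OF linear_D[OF M_tube]] q)
      also have "\<dots> = c * ((norm v / \<tau> + e) * norm (x - q))" using c by (simp add: algebra_simps)
      finally show "norm (D q (D x v)) \<le> (norm v / \<tau> + e) * norm (x - q)" using c by simp
    qed
  qed
qed

text \<open>Split \<open>u\<close> and \<open>h\<close> into tangent and normal parts at
  \<open>q\<close>. The mixed terms \<open>A1\<close> and \<open>A2\<close> are of first order and
  governed by \<open>D_normal_first_order\<close>. The pure terms \<open>A3\<close> and
  \<open>A4\<close> are of second order, because a projection deviates only quadratically in its
  diagonal blocks.\<close>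

lemma D_first_order:
  assumes q: "q \<in> M" and e: "e > 0"
  shows "\<forall>\<^sub>F x in nhds q. x \<in> M \<longrightarrow>
    \<bar>u \<bullet> (D x h - D q h)\<bar> \<le> (norm u * norm h / \<tau> + e) * norm (x - q)"
proof -
  note linq = linear_D[OF M_tube[OF q]]
  define uT where "uT = D q u" define uN where "uN = u - D q u"
  define hT where "hT = D q h" define hN where "hN = h - D q h"
  have N: "D q uN = 0" "D q hN = 0" by (simp_all add: uN_def hN_def linear_diff[OF linq] D_idem q)
  have T: "D q uT = uT" "D q hT = hT" by (simp_all add: uT_def hT_def D_idem q)
  have u: "u = uT + uN" and h: "h = hT + hN" by (simp_all add: uT_def uN_def hT_def hN_def)
  have le: "norm uT \<le> norm u" "norm uN \<le> norm u" "norm hT \<le> norm h" "norm hN \<le> norm h"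
    unfolding uT_def uN_def hT_def hN_def by (intro D_contraction D_co_contraction q)+
  obtain C d where C: "0 \<le> C" "0 < d"
    "\<And>x x' v. x \<in> M \<Longrightarrow> x' \<in> M \<Longrightarrow> dist x q < d \<Longrightarrow> dist x' q < d \<Longrightarrow> D x' v = 0 \<Longrightarrow>
      norm (D x v) \<le> C * norm (x - x') * norm v"
    using D_normal_locally_lipschitz[OF q] by metis
  define l where "l = norm u + norm h + 1"
  define e1 where "e1 = e / (2 * l)"
  have nuh: "l > 0" unfolding l_def by (intro add_nonneg_pos) auto
  have e1: "e1 > 0" using e nuh by (simp add: e1_def)
  have e1': "e1 * norm u + e1 * norm h \<le> e / 2"
  proof -
    have "e1 * norm u + e1 * norm h \<le> e1 * l" using e1 by (simp add: l_def algebra_simps)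
    also have "\<dots> = e / 2" using nuh by (simp add: e1_def)
    finally show ?thesis .
  qed
  \<comment> \<open>The 5 is \<open>1 + 4\<close>: \<open>A3\<close> contributes
    \<open>C ^ 2\<close>, and \<open>A4\<close> contributes \<open>(2 * C) ^ 2\<close>.\<close>
  define B where "B = 5 * C ^ 2 * norm u * norm h"
  define B1 where "B1 = B + 1"
  have B: "B \<ge> 0" "B1 > 0" by (simp_all add: B_def B1_def add_nonneg_pos)
  \<comment> \<open>Cauchy-Schwarz in the plane combined with Pythagoras keeps the constant at
    \<open>1 / \<tau>\<close>; separate bounds for the two mixed terms would double it.\<close>
  have cs: "norm uT * norm hN + norm uN * norm hT \<le> norm u * norm h"
  proof (rule power2_le_imp_le)
    have pu: "norm u ^ 2 = norm uT ^ 2 + norm uN ^ 2" and ph: "norm h ^ 2 = norm hT ^ 2 + norm hN ^ 2"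
      unfolding uT_def uN_def hT_def hN_def by (rule D_pythagoras[OF q])+
    have "0 \<le> (norm uT * norm hT - norm uN * norm hN) ^ 2" by simp
    then show "(norm uT * norm hN + norm uN * norm hT) ^ 2 \<le> (norm u * norm h) ^ 2"
      unfolding power_mult_distrib pu ph by (simp add: power2_eq_square algebra_simps)
  qed simp
  have "\<forall>\<^sub>F x in nhds q. dist x q < min d (e / (2 * B1))"
    unfolding eventually_nhds_metric
    by (intro exI[of _ "min d (e / (2 * B1))"]) (use C(2) e B in auto)
  with D_normal_first_order[OF q N(1) e1] D_normal_first_order[OF q N(2) e1]
  show ?thesis
  proof eventually_elim
    case (elim x)
    show ?case
    proof
      assume x: "x \<in> M"
      define a where "a = norm (x - q)"
      have a: "a \<ge> 0" "a < d" "B * a \<le> e / 2"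
      proof -
        show "a \<ge> 0" "a < d" using elim(3) by (auto simp: a_def dist_norm)
        have "B * a \<le> B1 * a" by (simp add: a_def B1_def algebra_simps)
        also have "\<dots> \<le> B1 * (e / (2 * B1))"
          using elim(3) B by (intro mult_left_mono) (auto simp: a_def dist_norm)
        also have "\<dots> = e / 2" using B by simp
        finally show "B * a \<le> e / 2" .
      qed
      have dq: "dist q q < d" and dx: "dist x q < d" using C(2) a(2) by (auto simp: a_def dist_norm)
      note linx = linear_D[OF M_tube[OF x]]
      have lipN: "norm (D x v) \<le> C * a * norm v" if "D q v = 0" for v
        using C(3)[OF x q dx dq that] by (simp add: a_def)
      have lipN': "norm (D q v) \<le> C * a * norm v" if "D x v = 0" for v
        using C(3)[OF q x dq dx that] by (simp add: a_def norm_minus_commute)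
      have lipT: "norm (v - D x v) \<le> 2 * (C * a) * norm v" if "D q v = v" for v
        using D_locally_lipschitz[OF x q _ lipN lipN', of v] that C(1) a(1) by (simp add: norm_minus_commute)
      define A1 where "A1 = uT \<bullet> D x hN" define A2 where "A2 = uN \<bullet> D x hT"
      define A3 where "A3 = uN \<bullet> D x hN" define A4 where "A4 = uT \<bullet> D x hT - uT \<bullet> hT"
      have split: "u \<bullet> (D x h - D q h) = A1 + A2 + A3 + A4"
      proof -
        have "uN \<bullet> hT = 0"
          using D_symmetric[OF M_tube[OF q], of uN h] by (simp add: N hT_def inner_commute)
        then have "u \<bullet> D q h = uT \<bullet> hT" unfolding u by (simp add: inner_add_left flip: hT_def)
        moreover have "u \<bullet> D x h = A1 + A2 + A3 + uT \<bullet> D x hT"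
          unfolding A1_def A2_def A3_def by (subst u, subst h) (simp add: linear_add[OF linx] inner_add)
        ultimately show ?thesis by (simp add: inner_diff_right A4_def)
      qed
      have "A1 = uT \<bullet> D q (D x hN)"
        using D_symmetric[OF M_tube[OF q], of uT "D x hN"] T by (simp add: A1_def inner_commute)
      then have "\<bar>A1\<bar> \<le> norm uT * norm (D q (D x hN))" by (simp add: Cauchy_Schwarz_ineq2)
      also have "\<dots> \<le> norm uT * ((norm hN / \<tau> + e1) * a)"
        using elim(2) x by (intro mult_left_mono) (auto simp: a_def)
      also have "\<dots> \<le> norm uT * norm hN / \<tau> * a + e1 * norm u * a"
        using le(1) e1 a(1) mult_right_mono[OF mult_left_mono[OF le(1), of e1], of a] by (simp add: algebra_simps)
      finally have A1: "\<bar>A1\<bar> \<le> norm uT * norm hN / \<tau> * a + e1 * norm u * a" .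
      have "A2 = D q (D x uN) \<bullet> hT"
        using D_symmetric[OF M_tube[OF q], of "D x uN" hT] D_symmetric[OF M_tube[OF x], of uN hT] T
        by (simp add: A2_def inner_commute)
      then have "\<bar>A2\<bar> \<le> norm (D q (D x uN)) * norm hT" by (simp add: Cauchy_Schwarz_ineq2)
      also have "\<dots> \<le> ((norm uN / \<tau> + e1) * a) * norm hT"
        using elim(1) x by (intro mult_right_mono) (auto simp: a_def)
      also have "\<dots> \<le> norm uN * norm hT / \<tau> * a + e1 * norm h * a"
        using le(3) e1 a(1) mult_right_mono[OF mult_left_mono[OF le(3), of e1], of a] by (simp add: algebra_simps)
      finally have A2: "\<bar>A2\<bar> \<le> norm uN * norm hT / \<tau> * a + e1 * norm h * a" .
      have "A3 = D x uN \<bullet> D x hN"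
        using D_inner_D[OF x, of hN uN] by (simp add: A3_def inner_commute)
      then have "\<bar>A3\<bar> \<le> norm (D x uN) * norm (D x hN)" by (simp add: Cauchy_Schwarz_ineq2)
      also have "\<dots> \<le> (C * a * norm u) * (C * a * norm h)"
        using C(1) a(1) le by (intro mult_mono order_trans[OF lipN] mult_nonneg_nonneg) (auto simp: N intro!: mult_left_mono)
      finally have A3: "\<bar>A3\<bar> \<le> (C * a * norm u) * (C * a * norm h)" .
      have "A4 = - ((uT - D x uT) \<bullet> (hT - D x hT))"
        using D_inner_D[OF x, of uT hT] D_symmetric[OF M_tube[OF x], of uT hT]
        by (simp add: A4_def inner_diff_left inner_diff_right inner_commute)
      then have "\<bar>A4\<bar> \<le> norm (uT - D x uT) * norm (hT - D x hT)" by (simp add: Cauchy_Schwarz_ineq2)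
      also have "\<dots> \<le> (2 * (C * a) * norm u) * (2 * (C * a) * norm h)"
        using C(1) a(1) le by (intro mult_mono order_trans[OF lipT] mult_nonneg_nonneg) (auto simp: T intro!: mult_left_mono)
      finally have A4: "\<bar>A4\<bar> \<le> (2 * (C * a) * norm u) * (2 * (C * a) * norm h)" .
      have A34: "\<bar>A3\<bar> + \<bar>A4\<bar> \<le> (B * a) * a"
        using A3 A4 by (simp add: B_def power2_eq_square algebra_simps)
      also have "\<dots> \<le> e / 2 * a" using a by (intro mult_right_mono)
      finally have A34: "\<bar>A3\<bar> + \<bar>A4\<bar> \<le> e / 2 * a" .
      have "\<bar>A1\<bar> + \<bar>A2\<bar> \<le> (norm uT * norm hN + norm uN * norm hT) / \<tau> * a + (e1 * norm u + e1 * norm h) * a"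
        using A1 A2 by (simp add: add_divide_distrib algebra_simps)
      also have "\<dots> \<le> norm u * norm h / \<tau> * a + e / 2 * a"
        using cs e1' a(1) \<tau>_pos by (intro add_mono mult_right_mono divide_right_mono) auto
      finally have "\<bar>A1 + A2 + A3 + A4\<bar> \<le> norm u * norm h / \<tau> * a + e / 2 * a + e / 2 * a"
        using A34 by linarith
      then show "\<bar>u \<bullet> (D x h - D q h)\<bar> \<le> (norm u * norm h / \<tau> + e) * norm (x - q)"
        unfolding split by (simp add: a_def algebra_simps)
    qed
  qed
qed

text \<open>
  The first-order bound is integrated along the projection of the segment from \<open>p\<close> to \<open>q\<close>, whose length is at
  most \<open>2 * norm (p - q)\<close>. This loses a factor \<open>2\<close> against the optimal constant, which the final estimate can afford.
\<close>

lemma D_on_M_lipschitz: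
  assumes p: "p \<in> M" and q: "q \<in> M" and near: "norm (q - p) \<le> \<tau>"
  shows "norm (D q h - D p h) \<le> 2 * norm (q - p) / \<tau> * norm h"
proof -
  define a where "a = norm (q - p)"
  have a: "0 \<le> a" "a \<le> \<tau>" using near by (auto simp: a_def)
  define y where "y t = p + t *\<^sub>R (q - p)" for t :: real
  define x where "x t = P (y t)" for t
  have x01: "x 0 = p" "x 1 = q" by (auto simp: x_def y_def P_self p q)
  have xM: "x t \<in> M" for t by (simp add: x_def P_in)
  \<comment> \<open>Each point of the segment is within \<open>a / 2\<close> of one endpoint, and
    both endpoints lie on \<open>M\<close>.\<close>
  have hy: "height (y t) \<le> a / 2" if "t \<in> {0..1}" for t
  proof (cases "t \<le> 1 / 2")
    case True
    have "height (y t) \<le> norm (y t - p)" by (rule height_le[OF p])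
    also have "\<dots> = t * a" using that by (simp add: y_def a_def)
    also have "\<dots> \<le> 1 / 2 * a" using True a by (intro mult_right_mono)
    finally show ?thesis by simp
  next
    case False
    have "height (y t) \<le> norm (y t - q)" by (rule height_le[OF q])
    also have "y t - q = (1 - t) *\<^sub>R (p - q)" by (simp add: y_def algebra_simps)
    also have "norm \<dots> = (1 - t) * a" using that by (simp add: a_def norm_minus_commute)
    also have "\<dots> \<le> 1 / 2 * a" using False a by (intro mult_right_mono) auto
    finally show ?thesis by simp
  qed
  have xlip: "norm (x s - x t) \<le> 2 * a * \<bar>s - t\<bar>" if "s \<in> {0..1}" "t \<in> {0..1}" for s t
  proof -
    have "1 / 2 \<le> 1 - (height (y s) + height (y t)) / (2 * \<tau>)"
      using hy[OF that(1)] hy[OF that(2)] a \<tau>_pos by (simp add: field_simps)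
    then have "1 / 2 * norm (x s - x t) \<le> norm (y s - y t)"
      unfolding x_def using P_lipschitz_strong[of "y s" "y t"]
      by (meson mult_right_mono norm_ge_zero order_trans)
    also have "y s - y t = (s - t) *\<^sub>R (q - p)" by (simp add: y_def algebra_simps)
    finally show ?thesis by (simp add: a_def mult_ac)
  qed
  \<comment> \<open>Pairing with a fixed \<open>u\<close> makes the problem scalar; \<open>u\<close>
    is finally taken to be the difference itself, which recovers its norm.\<close>
  have main: "\<bar>u \<bullet> (D q h - D p h)\<bar> \<le> 2 * a / \<tau> * (norm u * norm h) + e" if e: "e > 0" for u e
  proof -
    define e1 where "e1 = e / (2 * (a + 1))"
    have e1: "e1 > 0" using e a by (simp add: e1_def)
    define F where "F t = u \<bullet> D (x t) h" for t
    define K where "K = (norm u * norm h / \<tau> + e1) * (2 * a)"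
    have c: "0 \<le> norm u * norm h / \<tau> + e1" using e1 \<tau>_pos by simp
    have K: "K \<ge> 0" unfolding K_def using c a by simp
    have ev: "\<exists>\<delta>>0. \<forall>s\<in>{0..1}. \<bar>s - t\<bar> < \<delta> \<longrightarrow> dist (F s) (F t) \<le> K * \<bar>s - t\<bar>" if t: "t \<in> {0..1}" for t
    proof -
      obtain d where d: "d > 0" "\<And>z. dist z (x t) < d \<Longrightarrow> z \<in> M \<Longrightarrow>
          \<bar>u \<bullet> (D z h - D (x t) h)\<bar> \<le> (norm u * norm h / \<tau> + e1) * norm (z - x t)"
        using D_first_order[OF xM e1, of u h t] unfolding eventually_nhds_metric by blast
      show ?thesis
      proof (intro exI conjI ballI impI)
        show "d / (2 * a + 1) > 0" using d(1) a by simp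
        fix s assume s: "s \<in> {0..1}" and st: "\<bar>s - t\<bar> < d / (2 * a + 1)"
        have "norm (x s - x t) \<le> 2 * a * \<bar>s - t\<bar>" by (rule xlip[OF s t])
        also have "\<dots> \<le> (2 * a + 1) * \<bar>s - t\<bar>" by (simp add: algebra_simps)
        also have "\<dots> < d" using st a by (simp add: field_simps)
        finally have "dist (x s) (x t) < d" by (simp add: dist_norm)
        from d(2)[OF this xM] have "dist (F s) (F t) \<le> (norm u * norm h / \<tau> + e1) * norm (x s - x t)"
          by (simp add: F_def dist_real_def inner_diff_right)
        also have "\<dots> \<le> (norm u * norm h / \<tau> + e1) * (2 * a * \<bar>s - t\<bar>)"
          using xlip[OF s t] c by (rule mult_left_mono)
        finally show "dist (F s) (F t) \<le> K * \<bar>s - t\<bar>" by (simp only: K_def mult.assoc)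
      qed
    qed
    have "K-lipschitz_on {0..1} F"
    \<comment> \<open>This replaces integration: \<open>F\<close> is not known to be differentiable,
      but near each \<open>t\<close> its increments from \<open>F t\<close> are bounded with the
      same constant \<open>K\<close>.\<close>
    proof (rule locally_lipschitz_imp_lipschitz[OF _ _ K])
      show "continuous_on {0..1} F"
        unfolding continuous_on_iff
      proof (intro ballI allI impI)
        fix t r :: real assume t: "t \<in> {0..1}" and r: "r > 0"
        obtain \<delta> where \<delta>: "\<delta> > 0" "\<And>s. s \<in> {0..1} \<Longrightarrow> \<bar>s - t\<bar> < \<delta> \<Longrightarrow> dist (F s) (F t) \<le> K * \<bar>s - t\<bar>"
          using ev[OF t] by blast
        show "\<exists>\<delta>>0. \<forall>s\<in>{0..1}. dist s t < \<delta> \<longrightarrow> dist (F s) (F t) < r"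
        proof (intro exI conjI ballI impI)
          show "min \<delta> (r / (K + 1)) > 0" using \<delta>(1) r K by simp
          fix s assume s: "s \<in> {0..1}" "dist s t < min \<delta> (r / (K + 1))"
          have "dist (F s) (F t) \<le> K * \<bar>s - t\<bar>" using s by (intro \<delta>(2)) (auto simp: dist_real_def)
          also have "\<dots> \<le> (K + 1) * \<bar>s - t\<bar>" by (simp add: algebra_simps)
          also have "\<dots> < r" using s(2) K by (simp add: dist_real_def field_simps)
          finally show "dist (F s) (F t) < r" .
        qed
      qed
      fix t t' :: real assume t: "t \<in> {0..<1}" "t < t'"
      obtain \<delta> where \<delta>: "\<delta> > 0" "\<And>s. s \<in> {0..1} \<Longrightarrow> \<bar>s - t\<bar> < \<delta> \<Longrightarrow> dist (F s) (F t) \<le> K * \<bar>s - t\<bar>"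
        using ev[of t] t by auto
      define s where "s = min (min t' 1) (t + \<delta> / 2)"
      have s: "t < s" "s \<le> t'" "s \<le> 1" "s < t + \<delta>" using t \<delta>(1) by (auto simp: s_def)
      show "\<exists>s\<in>{t<..t'}. dist (F s) (F t) \<le> K * (s - t)"
        using \<delta>(2)[of s] s t by (intro bexI[of _ s]) auto
    qed
    from lipschitz_onD[OF this, of 1 0] have "\<bar>F 1 - F 0\<bar> \<le> K" by (simp add: dist_real_def)
    moreover have "F 1 - F 0 = u \<bullet> (D q h - D p h)" by (simp add: F_def x01 inner_diff_right)
    moreover have "K \<le> 2 * a / \<tau> * (norm u * norm h) + e"
    proof -
      have "e1 * (2 * a) \<le> e1 * (2 * (a + 1))" using e1 by simp
      also have "\<dots> = e" using a by (simp add: e1_def)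
      finally show ?thesis by (simp add: K_def algebra_simps)
    qed
    ultimately show ?thesis by simp
  qed
  define u where "u = D q h - D p h"
  have "norm u * norm u \<le> 2 * a / \<tau> * (norm u * norm h)"
    using field_le_epsilon[OF main, of u] by (simp add: u_def power2_eq_square flip: power2_norm_eq_inner)
  then have *: "norm u * norm u \<le> norm u * (2 * a / \<tau> * norm h)" by (simp add: mult_ac)
  show ?thesis
  proof (cases "u = 0")
    case False
    then have "0 < norm u" by simp
    with * have "norm u \<le> 2 * a / \<tau> * norm h" by (rule mult_left_le_imp_le)
    then show ?thesis by (simp add: u_def a_def)
  qed (use \<tau>_pos in \<open>auto simp: u_def\<close>)
qed

section \<open>From points of \<open>M\<close> to points of the tube\<close>

text \<open>The difference splits into a vector tangent at \<open>q\<close>, coming from the part of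
  \<open>h\<close> normal at \<open>p\<close>, and a vector normal at \<open>q\<close>, coming from
  the part tangent at \<open>p\<close>. Pythagoras at \<open>q\<close> and then at \<open>p\<close>
  gives the constant 1.\<close>

lemma D_diff_le:
  assumes p: "p \<in> M" and q: "q \<in> M"
  shows "norm (D q h - D p h) \<le> norm h"
proof (rule power2_le_imp_le)
  note lin = linear_diff[OF linear_D[OF M_tube[OF q]]]
  define n where "n = h - D p h"
  have split: "D q h - D p h = D q n - (D p h - D q (D p h))" by (simp add: n_def lin)
  have orth: "D q n \<bullet> (D p h - D q (D p h)) = 0"
    using D_inner_D[OF q, of n "D p h"] by (simp add: inner_diff_right)
  have "norm (D q h - D p h) ^ 2 = norm (D q n) ^ 2 + norm (D p h - D q (D p h)) ^ 2"
    unfolding split power2_norm_eq_inner using orth by (simp add: inner_diff inner_commute)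
  also have "\<dots> \<le> norm n ^ 2 + norm (D p h) ^ 2"
    by (intro add_mono power_mono D_contraction D_co_contraction q) auto
  also have "\<dots> = norm h ^ 2" using D_pythagoras[OF p, of h] by (simp add: n_def)
  finally show "norm (D q h - D p h) ^ 2 \<le> norm h ^ 2" .
qed simp

text \<open>Law of cosines in the triangle \<open>m\<close>, \<open>y\<close>, \<open>P y\<close>;
  the tangent ball at \<open>P y\<close> bounds the term containing the angle.\<close>

lemma foot_points_distance:
  assumes m: "m \<in> M"
  shows "norm (m - P y) ^ 2 * (\<tau> - height y) \<le> \<tau> * (norm (y - m) ^ 2 - height y ^ 2)"
proof -
  define X where "X = (m - P y) \<bullet> (y - P y)"
  have "2 * \<tau> * \<bar>X\<bar> \<le> norm (m - P y) ^ 2 * height y"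
    unfolding height_def X_def by (rule inner_normal_le[OF P_in m P_normal])
  moreover have "2 * \<tau> * X \<le> 2 * \<tau> * \<bar>X\<bar>" using \<tau>_pos by simp
  ultimately have X: "2 * \<tau> * X \<le> norm (m - P y) ^ 2 * height y" by linarith
  have n: "norm (y - m) ^ 2 = height y ^ 2 - 2 * X + norm (m - P y) ^ 2"
    unfolding height_def power2_norm_eq_inner X_def by (simp add: inner_diff inner_commute)
  show ?thesis unfolding n using X by (simp add: algebra_simps)
qed

lemma D_diff_bound:
  assumes m: "m \<in> M" and r: "norm (y - m) \<le> \<epsilon>" and \<epsilon>: "\<epsilon> < \<tau>"
  shows "norm (D y u - D m u) \<le> (2 / \<tau> + 1 / (\<tau> - \<epsilon>)) * norm (y - m) * norm u"
proof -
  define r where "r = norm (y - m)"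
  define d where "d = height y"
  define a where "a = norm (m - P y)"
  have d: "0 \<le> d" "d \<le> r" "r < \<tau>" "r \<le> \<epsilon>"
    using height_nonneg height_le[OF m] assms by (auto simp: d_def r_def)
  have y: "y \<in> tube" using d by (simp add: tube_def d_def)
  have off: "norm (D y u - D (P y) u) \<le> d / (\<tau> - d) * norm u"
    using D_off_M[OF y, of u] d unfolding d_def[symmetric] by (simp add: field_simps)
  have r\<epsilon>: "r / (\<tau> - r) \<le> r / (\<tau> - \<epsilon>)" using d \<epsilon> by (intro divide_left_mono) auto
  \<comment> \<open>The bound is first proved with \<open>r\<close> in place of \<epsilon>. Here
    \<open>c\<close> bounds the change of \<open>D\<close> along \<open>M\<close> from
    \<open>m\<close> to \<open>P y\<close>.\<close>
  obtain c where c: "norm (D (P y) u - D m u) \<le> c * norm u" "c + d / (\<tau> - d) \<le> 2 * r / \<tau> + r / (\<tau> - r)"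
  proof (cases "\<tau> \<le> 2 * r")
    case True
    have "d / (\<tau> - d) \<le> r / (\<tau> - r)" using d by (intro frac_le) auto
    moreover have "1 \<le> 2 * r / \<tau>" using True \<tau>_pos by simp
    ultimately show ?thesis using that[of 1] D_diff_le[OF m P_in, of y u] by simp
  next
    case False
    have a2: "2 * a \<le> 3 * r - d"
      using False d foot_points_distance[OF m, of y]
      by (intro foot_distance_arith[of d r \<tau>]) (auto simp: a_def d_def r_def)
    have "a \<le> norm (m - y) + norm (y - P y)" unfolding a_def using norm_triangle_ineq[of "m - y" "y - P y"] by simp
    then have "a \<le> \<tau>" using False d by (simp add: d_def r_def height_def norm_minus_commute)
    then have D: "norm (D (P y) u - D m u) \<le> 2 * a / \<tau> * norm u"
      using D_on_M_lipschitz[OF m P_in, of y u] by (simp add: a_def norm_minus_commute)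
    \<comment> \<open>The right side is the gap between \<open>r / (\<tau> - r)\<close> and
      \<open>d / (\<tau> - d)\<close>; it absorbs the excess of \<open>2 * a / \<tau>\<close> over
      \<open>2 * r / \<tau>\<close>.\<close>
    have "(r - d) / \<tau> \<le> \<tau> * (r - d) / ((\<tau> - r) * (\<tau> - d))"
    proof -
      have "(\<tau> - r) * (\<tau> - d) \<le> \<tau> * \<tau>" using d by (intro mult_mono) auto
      then have "(r - d) * ((\<tau> - r) * (\<tau> - d)) \<le> (r - d) * (\<tau> * \<tau>)" using d by (intro mult_left_mono) auto
      then show ?thesis using d \<tau>_pos by (simp add: frac_le_eq divide_le_eq pos_le_divide_eq mult_ac)
    qed
    also have "\<dots> = r / (\<tau> - r) - d / (\<tau> - d)" using d by (simp add: field_simps)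
    finally have "(r - d) / \<tau> + d / (\<tau> - d) \<le> r / (\<tau> - r)" by simp
    moreover have "2 * a / \<tau> \<le> 2 * r / \<tau> + (r - d) / \<tau>"
      using a2 \<tau>_pos by (simp add: divide_right_mono flip: add_divide_distrib)
    ultimately show ?thesis using that[OF D] by simp
  qed
  have "norm (D y u - D m u) \<le> norm (D y u - D (P y) u) + norm (D (P y) u - D m u)"
    using norm_triangle_ineq[of "D y u - D (P y) u" "D (P y) u - D m u"] by simp
  also have "\<dots> \<le> (c + d / (\<tau> - d)) * norm u" using off c(1) by (simp add: algebra_simps)
  also have "\<dots> \<le> (2 * r / \<tau> + r / (\<tau> - \<epsilon>)) * norm u" using c(2) r\<epsilon> by (intro mult_right_mono) auto
  finally show ?thesis by (simp add: r_def algebra_simps)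
qed

end

section \<open>The estimate on Riemannian manifolds\<close>

context smooth_positive_reach
begin

lemma projection_derivative_bound:
  fixes F Ft :: "'e::real_normed_vector \<Rightarrow> 'a"
  assumes W: "open W" "p \<in> W" "F ` W \<subseteq> M"
    and dF: "(F has_derivative dF) (at p)" and dFt: "(Ft has_derivative dFt) (at p)"
    and r: "norm (F p - Ft p) \<le> \<epsilon>" and \<epsilon>: "\<epsilon> < \<tau>"
  obtains dI where "((P \<circ> Ft) has_derivative dI) (at p)"
    "\<And>v. norm (dI v - dF v) \<le> norm (dFt v - dF v)
      + (2 / \<tau> + 1 / (\<tau> - \<epsilon>)) * norm (F p - Ft p) * norm (dFt v)"
proof
  have m: "F p \<in> M" using W by auto
  have r': "norm (Ft p - F p) \<le> \<epsilon>" using r by (simp add: norm_minus_commute)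
  have tube: "Ft p \<in> tube" using r' \<epsilon> by (intro tubeI[OF m]) simp
  show "((P \<circ> Ft) has_derivative (\<lambda>v. D (Ft p) (dFt v))) (at p)"
    using has_derivative_compose[OF dFt D[OF tube]] by (simp add: comp_def)
  fix v
  have "((\<lambda>z. P (F z)) has_derivative (\<lambda>v. D (F p) (dF v))) (at p)"
    by (rule has_derivative_compose[OF dF D[OF M_tube[OF m]]])
  then have "(F has_derivative (\<lambda>v. D (F p) (dF v))) (at p)"
    by (rule has_derivative_transform_within_open[OF _ W(1,2)]) (use W(3) P_self in auto)
  from has_derivative_unique[OF this dF] have "D (F p) (dF v) = dF v" by metis
  then have "D (Ft p) (dFt v) - dF v = (D (Ft p) (dFt v) - D (F p) (dFt v)) + D (F p) (dFt v - dF v)"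
    by (simp add: linear_diff[OF linear_D[OF M_tube[OF m]]])
  also have "norm \<dots> \<le> norm (D (Ft p) (dFt v) - D (F p) (dFt v)) + norm (D (F p) (dFt v - dF v))"
    by (rule norm_triangle_ineq)
  also have "\<dots> \<le> (2 / \<tau> + 1 / (\<tau> - \<epsilon>)) * norm (Ft p - F p) * norm (dFt v) + norm (dFt v - dF v)"
    by (intro add_mono D_diff_bound[OF m r' \<epsilon>] D_contraction[OF m])
  finally show "norm (D (Ft p) (dFt v) - dF v) \<le> norm (dFt v - dF v)
      + (2 / \<tau> + 1 / (\<tau> - \<epsilon>)) * norm (F p - Ft p) * norm (dFt v)"
    by (simp add: norm_minus_commute)
qed

end

section \<open>Spectral norms with respect to an inner product\<close>

text \<open>A real supremum dominates its terms only if the family is bounded. The minimum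
  \<open>c\<close> of \<open>q\<close> on the compact unit sphere is positive and bounds
  \<open>sqrt (q v v)\<close> below by a multiple of \<open>norm v\<close>.\<close>

lemma norm_le_spectral_norm:
  fixes L :: "'e::euclidean_space \<Rightarrow> 'b::real_normed_vector"
  assumes q: "bilinear q" "\<And>v. v \<noteq> 0 \<Longrightarrow> 0 < q v v" and L: "bounded_linear L"
  shows "norm (L v) \<le> spectral_norm q L * sqrt (q v v)"
proof -
  interpret q: bounded_bilinear q using q(1) by (simp add: bilinear_conv_bounded_bilinear)
  have "\<exists>e\<in>sphere 0 1. \<forall>v\<in>sphere (0::'e) 1. q e e \<le> q v v"
    by (rule continuous_attains_inf) (auto intro!: continuous_intros q.continuous_on)
  then obtain e :: 'e where e: "norm e = 1" "\<And>v. norm v = 1 \<Longrightarrow> q e e \<le> q v v" by auto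
  define c where "c = q e e"
  have c: "c > 0" unfolding c_def using e(1) by (intro q(2)) auto
  have q_ge: "c * norm v ^ 2 \<le> q v v" for v
  proof (cases "v = 0")
    case False
    have "c \<le> q (v /\<^sub>R norm v) (v /\<^sub>R norm v)" unfolding c_def using False by (intro e(2)) simp
    also have "\<dots> = q v v / norm v ^ 2"
      by (simp add: q.scaleR_left q.scaleR_right power2_eq_square divide_inverse)
    finally show ?thesis using False by (simp add: pos_le_divide_eq)
  qed (simp add: q.zero_left)
  have sqrt_ge: "sqrt c * norm v \<le> sqrt (q v v)" for v
    using real_sqrt_le_mono[OF q_ge[of v]] by (simp add: real_sqrt_mult)
  obtain B where B: "\<And>v. norm (L v) \<le> norm v * B" "B \<ge> 0"
    using bounded_linear.nonneg_bounded[OF L] by blast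
  have "norm (L v) / sqrt (q v v) \<le> B / sqrt c" for v
  proof (cases "v = 0")
    case False
    have "norm (L v) / sqrt (q v v) \<le> (norm v * B) / (sqrt c * norm v)"
      using False c B sqrt_ge[of v] by (intro frac_le) auto
    also have "\<dots> = B / sqrt c" using False by simp
    finally show ?thesis .
  qed (use B(2) c q.zero_left in auto)
  then have "bdd_above (range (\<lambda>v. norm (L v) / sqrt (q v v)))" by (intro bdd_aboveI2)
  then have le: "norm (L v) / sqrt (q v v) \<le> spectral_norm q L"
    unfolding spectral_norm_def by (rule cSUP_upper[OF UNIV_I])
  show ?thesis
  proof (cases "v = 0")
    case False
    then have "0 < sqrt (q v v)" using q(2) by simp
    with le show ?thesis by (simp add: pos_divide_le_eq)
  qed (simp add: q.zero_left linear_0 bounded_linear.linear[OF L])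
qed

lemma spectral_norm_le:
  assumes "\<And>v. norm (L v) \<le> B * sqrt (q v v)" "\<And>v. v \<noteq> 0 \<Longrightarrow> 0 < q v v" "0 \<le> B" "q 0 0 = 0"
  shows "spectral_norm q L \<le> B"
  unfolding spectral_norm_def
proof (rule cSUP_least)
  fix v show "norm (L v) / sqrt (q v v) \<le> B"
  proof (cases "v = 0")
    case False
    then have "0 < sqrt (q v v)" using assms(2) by simp
    then show ?thesis using assms(1)[of v] by (simp add: pos_divide_le_eq)
  \<comment> \<open>At \<open>v = 0\<close> the quotient is division by zero, hence 0, and
    \<open>0 \<le> B\<close> settles it.\<close>
  qed (use assms in simp)
qed simp

lemma spectral_norm_nonneg:
  assumes "bilinear q" "\<And>v. v \<noteq> 0 \<Longrightarrow> 0 < q v v" "bounded_linear L"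
  shows "0 \<le> spectral_norm q (L :: 'e::euclidean_space \<Rightarrow> 'b::real_normed_vector)"
proof -
  obtain e :: 'e where e: "e \<in> Basis" using nonempty_Basis by blast
  then have "0 < sqrt (q e e)" using assms(2)[of e] nonzero_Basis by auto
  moreover have "0 \<le> spectral_norm q L * sqrt (q e e)"
    using norm_le_spectral_norm[OF assms, of e] by (rule order_trans[OF norm_ge_zero])
  ultimately show ?thesis by (simp add: zero_le_mult_iff)
qed

lemma spectral_norm_projection_bound:
  fixes dF dFt dI :: "'e::euclidean_space \<Rightarrow> 'b::real_normed_vector"
  assumes q: "bilinear q" "\<And>v. v \<noteq> 0 \<Longrightarrow> 0 < q v v"
    and bl: "bounded_linear dF" "bounded_linear dFt" and K: "0 \<le> K"
    and le: "\<And>v. norm (dI v - dF v) \<le> norm (dFt v - dF v) + K * norm (dFt v)"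
  shows "spectral_norm q (\<lambda>v. dI v - dF v) \<le> spectral_norm q (\<lambda>v. dFt v - dF v)
    + K * (spectral_norm q (\<lambda>v. dFt v - dF v) + spectral_norm q dF)" (is "_ \<le> ?\<alpha> + K * (_ + ?\<beta>)")
proof (rule spectral_norm_le)
  have bl': "bounded_linear (\<lambda>v. dFt v - dF v)" using bl by (intro bounded_linear_sub)
  show "0 \<le> ?\<alpha> + K * (?\<alpha> + ?\<beta>)"
    using K spectral_norm_nonneg[OF q bl'] spectral_norm_nonneg[OF q bl(1)] by simp
  show "q 0 0 = 0" using q(1) by (simp add: bilinear_lzero)
  fix v
  let ?s = "sqrt (q v v)"
  have 1: "norm (dFt v - dF v) \<le> ?\<alpha> * ?s" by (rule norm_le_spectral_norm[OF q bl'])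
  have "norm (dFt v) \<le> norm (dFt v - dF v) + norm (dF v)"
    using norm_triangle_ineq[of "dFt v - dF v" "dF v"] by simp
  also have "\<dots> \<le> (?\<alpha> + ?\<beta>) * ?s"
    using 1 norm_le_spectral_norm[OF q bl(1), of v] by (simp add: algebra_simps)
  finally have "K * norm (dFt v) \<le> K * ((?\<alpha> + ?\<beta>) * ?s)" using K by (rule mult_left_mono)
  with 1 le[of v] show "norm (dI v - dF v) \<le> (?\<alpha> + K * (?\<alpha> + ?\<beta>)) * ?s"
    by (simp add: algebra_simps)
qed (fact q(2))

text \<open>
  The reach need not satisfy the injectivity condition a priori, so the estimate is obtained for all smaller
  radii \<open>t\<close>. The limit also covers an infinite reach, where both reciprocals vanish.
\<close>

lemma reach_limit_bound:
  fixes \<tau> :: ereal and \<epsilon> B \<alpha> \<beta> r :: real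
  assumes \<epsilon>: "0 \<le> \<epsilon>" "ereal \<epsilon> < \<tau>"
    and bound: "\<And>t. \<epsilon> < t \<Longrightarrow> ereal t < \<tau> \<Longrightarrow> B \<le> \<alpha> + (2 / t + 1 / (t - \<epsilon>)) * r * \<beta>"
  shows "ereal B \<le> ereal \<alpha> + (2 / \<tau> + 1 / (\<tau> - ereal \<epsilon>)) * ereal \<beta> * ereal r"
proof (cases \<tau>)
  case (real T)
  then have T: "\<epsilon> < T" "0 < T" using \<epsilon> by auto
  have "B \<le> \<alpha> + (2 / T + 1 / (T - \<epsilon>)) * r * \<beta>"
  proof (rule tendsto_lowerbound)
    show "((\<lambda>t. \<alpha> + (2 / t + 1 / (t - \<epsilon>)) * r * \<beta>) \<longlongrightarrow> \<alpha> + (2 / T + 1 / (T - \<epsilon>)) * r * \<beta>) (at_left T)"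
      using T by (intro tendsto_intros) auto
    show "\<forall>\<^sub>F t in at_left T. B \<le> \<alpha> + (2 / t + 1 / (t - \<epsilon>)) * r * \<beta>"
      unfolding eventually_at_left_field using T bound real by (intro exI[of _ \<epsilon>]) auto
  qed simp
  moreover have "2 / \<tau> = ereal (2 / T)" "1 / (\<tau> - ereal \<epsilon>) = ereal (1 / (T - \<epsilon>))"
    using T by (simp_all add: real one_ereal_def numeral_eq_ereal)
  ultimately show ?thesis by (simp add: mult_ac)
next
  case PInf
  have "B \<le> \<alpha> + (0 + 0) * r * \<beta>"
  proof (rule tendsto_lowerbound)
    have "LIM t at_top. t - \<epsilon> :> at_top"
      using filterlim_tendsto_add_at_top[OF tendsto_const filterlim_ident, of "- \<epsilon>"] by simp
    then have "((\<lambda>t. 1 / (t - \<epsilon>)) \<longlongrightarrow> 0) at_top" "((\<lambda>t::real. 2 / t) \<longlongrightarrow> 0) at_top"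
      by (auto intro!: tendsto_divide_0[OF tendsto_const] filterlim_at_top_imp_at_infinity filterlim_ident)
    then show "((\<lambda>t. \<alpha> + (2 / t + 1 / (t - \<epsilon>)) * r * \<beta>) \<longlongrightarrow> \<alpha> + (0 + 0) * r * \<beta>) at_top"
      by (intro tendsto_intros)
    show "\<forall>\<^sub>F t in at_top. B \<le> \<alpha> + (2 / t + 1 / (t - \<epsilon>)) * r * \<beta>"
      using eventually_gt_at_top[of \<epsilon>] by eventually_elim (use bound PInf in auto)
  qed simp
  then show ?thesis using PInf by simp
qed (use \<epsilon> in auto)

theorem theorem3p2:
  fixes \<Omega> :: "'p topology"
    and A :: "('p, 'e::euclidean_space) chart set"
    and G :: "('p, 'e) chart \<Rightarrow> 'p \<Rightarrow> 'e \<Rightarrow> 'e \<Rightarrow> real"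
    and M :: "(real ^ 'd) set"
    and k :: nat
    and \<tau> :: ereal
    and \<epsilon> :: real
    and I :: "('p \<Rightarrow> real ^ 'd) \<Rightarrow> 'p \<Rightarrow> real ^ 'd"
    and f ft IMf :: "'p \<Rightarrow> real ^ 'd"
  assumes \<Omega>: "riemannian_manifold \<Omega> A G"
    and M: "smooth_submanifold k M" "compact M"
    and \<tau>: "\<tau> = reach M"
    and \<epsilon>: "ereal \<epsilon> < \<tau>"
    and I: "\<And>g. continuous_map \<Omega> euclidean g \<Longrightarrow> continuous_map \<Omega> euclidean (I g)"
    and f: "C1_in A f" "f ` topspace \<Omega> \<subseteq> M"
    and ft: "ft = I f"
    and ft_diff: "\<And>x. x \<in> topspace \<Omega> \<Longrightarrow> differentiable_in A ft x"
    and ft_close: "\<And>x. x \<in> topspace \<Omega> \<Longrightarrow> norm (f x - ft x) \<le> \<epsilon>"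
    and IMf: "IMf = closest_point M \<circ> ft"
  shows "\<forall>x\<in>topspace \<Omega>.
    infdist (ft x) M \<le> \<epsilon> \<and>
    differentiable_in A IMf x \<and>
    (\<forall>c\<in>A. x \<in> fst c \<longrightarrow>
      (let df = chart_deriv c f x;
           dft = chart_deriv c ft x;
           dIMf = chart_deriv c IMf x;
           nrm = spectral_norm (G c x);
           C = (2 / \<tau> + 1 / (\<tau> - ereal \<epsilon>)) * ereal (nrm (\<lambda>v. dft v - df v) + nrm df)
       in ereal (nrm (\<lambda>v. dIMf v - df v))
            \<le> ereal (nrm (\<lambda>v. dft v - df v)) + C * ereal (norm (f x - ft x))))"
proof (intro ballI)
  fix x assume x: "x \<in> topspace \<Omega>"
  define r where "r = norm (f x - ft x)"
  have fx: "f x \<in> M" using f(2) x by auto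
  have r: "norm (f x - ft x) \<le> \<epsilon>" by (rule ft_close[OF x])
  \<comment> \<open>Closeness at the point \<open>x\<close> forces \<epsilon> to be nonnegative, so
    the radii \<open>t\<close> below are positive; likewise \<open>f x\<close> shows that
    \<open>M\<close> is nonempty.\<close>
  have \<epsilon>0: "0 \<le> \<epsilon>" using r norm_ge_zero order_trans by blast
  have reach: "smooth_positive_reach M t k" if "\<epsilon> < t" "ereal t < \<tau>" for t
  proof -
    obtain t' where "t < t'"
      and "inj_on (\<lambda>(m, v). m + v) {(m, v). m \<in> M \<and> v \<in> normal_space M m \<and> norm v < t'}"
      using \<open>ereal t < \<tau>\<close> unfolding \<tau> reach_def less_Sup_iff by auto
    then have "inj_on (\<lambda>(m, v). m + v) {(m, v). m \<in> M \<and> v \<in> normal_space M m \<and> norm v < t}"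
      by (elim inj_on_subset) auto
    then show ?thesis using M fx that \<epsilon>0 by unfold_locales auto
  qed
  have chart: "\<exists>W p dF dFt. open W \<and> p \<in> W \<and> in_coords c f ` W \<subseteq> M \<and> p = snd c x \<and>
      in_coords c f p = f x \<and> in_coords c ft p = ft x \<and>
      (in_coords c f has_derivative dF) (at p) \<and> (in_coords c ft has_derivative dFt) (at p)"
    if c: "c \<in> A" "x \<in> fst c" for c
  proof -
    obtain U \<phi> where c_eq: "c = (U, \<phi>)" by (cases c)
    have U: "openin \<Omega> U" "open (\<phi> ` U)" "homeomorphic_map (subtopology \<Omega> U) (top_of_set (\<phi> ` U)) \<phi>"
      using \<Omega> c(1) unfolding c_eq riemannian_manifold_def smooth_atlas_def by blast+
    have U\<Omega>: "U \<subseteq> topspace \<Omega>" using U(1) by (rule openin_subset)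
    have inj: "inj_on \<phi> U"
      using homeomorphic_imp_injective_map[OF U(3)] U\<Omega> by (simp add: Int_absorb1)
    have coords: "in_coords c g (\<phi> z) = g z" if "z \<in> U" for g :: "'p \<Rightarrow> real ^ 'd" and z
      using that inj by (simp add: c_eq in_coords_def)
    have xU: "x \<in> U" using c by (simp add: c_eq)
    have "Ck_on (Suc 0) (\<phi> ` U) (in_coords c f)" using f(1) c(1) by (force simp: C1_in_def c_eq)
    then obtain dF where dF: "(in_coords c f has_derivative dF) (at (\<phi> x))"
      using xU unfolding Ck_on.simps by blast
    obtain dFt where dFt: "(in_coords c ft has_derivative dFt) (at (\<phi> x))"
      using ft_diff[OF x] c unfolding differentiable_in_def differentiable_def by (auto simp: c_eq)
    have "in_coords c f ` \<phi> ` U \<subseteq> M" 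
      using coords f(2) U\<Omega> by (auto simp: image_subset_iff subset_iff)
    with U(2) xU dF dFt coords[OF xU] show ?thesis
      by (intro exI[of _ "\<phi> ` U"] exI[of _ "\<phi> x"] exI[of _ dF] exI[of _ dFt]) (simp add: c_eq)
  qed
  have IMf': "in_coords c IMf = closest_point M \<circ> in_coords c ft" for c
    by (simp add: IMf in_coords_def comp_assoc)
  show "infdist (ft x) M \<le> \<epsilon> \<and> differentiable_in A IMf x \<and>
    (\<forall>c\<in>A. x \<in> fst c \<longrightarrow>
      (let df = chart_deriv c f x;
           dft = chart_deriv c ft x;
           dIMf = chart_deriv c IMf x;
           nrm = spectral_norm (G c x);
           C = (2 / \<tau> + 1 / (\<tau> - ereal \<epsilon>)) * ereal (nrm (\<lambda>v. dft v - df v) + nrm df)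
       in ereal (nrm (\<lambda>v. dIMf v - df v))
            \<le> ereal (nrm (\<lambda>v. dft v - df v)) + C * ereal (norm (f x - ft x))))"
  proof (intro conjI ballI impI)
    have "infdist (ft x) M \<le> dist (ft x) (f x)" by (rule infdist_le[OF fx])
    with r show "infdist (ft x) M \<le> \<epsilon>" by (simp add: dist_norm norm_minus_commute)
    \<comment> \<open>One admissible radius is enough for differentiability; the estimate needs all
      of them.\<close>
    obtain t where t: "\<epsilon> < t" "ereal t < \<tau>" using ereal_dense2[OF \<epsilon>] by auto
    interpret smooth_positive_reach M t k by (rule reach[OF t])
    show "differentiable_in A IMf x"
      unfolding differentiable_in_def IMf'
    proof (intro ballI impI)
      fix c assume "c \<in> A" "x \<in> fst c"
      from chart[OF this] obtain W dF dFt where *: "open W" "snd c x \<in> W" "in_coords c f ` W \<subseteq> M"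
        "in_coords c f (snd c x) = f x" "in_coords c ft (snd c x) = ft x"
        "(in_coords c f has_derivative dF) (at (snd c x))"
        "(in_coords c ft has_derivative dFt) (at (snd c x))" by blast
      show "(closest_point M \<circ> in_coords c ft) differentiable at (snd c x)"
        by (rule projection_derivative_bound[OF *(1-3,6,7) _ t(1)])
          (use r *(4,5) in \<open>auto intro: differentiableI\<close>)
    qed
  next
    fix c assume c: "c \<in> A" "x \<in> fst c"
    from chart[OF this] obtain W dF dFt where *: "open W" "snd c x \<in> W" "in_coords c f ` W \<subseteq> M"
      "in_coords c f (snd c x) = f x" "in_coords c ft (snd c x) = ft x"
      "(in_coords c f has_derivative dF) (at (snd c x))"
      "(in_coords c ft has_derivative dFt) (at (snd c x))" by blast
    have q: "bilinear (G c x)" "\<And>v. v \<noteq> 0 \<Longrightarrow> 0 < G c x v v"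
      using \<Omega> c unfolding riemannian_manifold_def riemannian_metric_def by blast+
    have df: "chart_deriv c f x = dF" and dft: "chart_deriv c ft x = dFt"
      using *(6,7) unfolding chart_deriv_def by (metis frechet_derivative_at)+
    define nrm where "nrm = (spectral_norm (G c x) :: ('e \<Rightarrow> real ^ 'd) \<Rightarrow> real)"
    have "nrm (\<lambda>v. chart_deriv c IMf x v - dF v) \<le> nrm (\<lambda>v. dFt v - dF v)
        + (2 / t + 1 / (t - \<epsilon>)) * r * (nrm (\<lambda>v. dFt v - dF v) + nrm dF)"
      if t: "\<epsilon> < t" "ereal t < \<tau>" for t
    proof -
      interpret smooth_positive_reach M t k by (rule reach[OF t])
      have "norm (in_coords c f (snd c x) - in_coords c ft (snd c x)) \<le> \<epsilon>" using r *(4,5) by simp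
      from projection_derivative_bound[OF *(1-3,6,7) this t(1)]
      obtain dI where dI: "(closest_point M \<circ> in_coords c ft has_derivative dI) (at (snd c x))"
        "\<And>v. norm (dI v - dF v) \<le> norm (dFt v - dF v) + (2 / t + 1 / (t - \<epsilon>)) * r * norm (dFt v)"
        unfolding *(4,5) r_def by metis
      \<comment> \<open>The map \<open>closest_point M\<close> does not involve \<open>t\<close>, so
        uniqueness of derivatives gives the same left side for every radius, and the limit may be
        taken in the constant alone.\<close>
      have dIMf: "chart_deriv c IMf x = dI"
        using dI(1) unfolding chart_deriv_def IMf' by (metis frechet_derivative_at)
      have K: "0 \<le> (2 / t + 1 / (t - \<epsilon>)) * r" using \<epsilon>0 t by (simp add: r_def)
      show ?thesis
        unfolding nrm_def dIMf
        by (rule spectral_norm_projection_bound[OF q has_derivative_bounded_linear[OF *(6)]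
              has_derivative_bounded_linear[OF *(7)] K dI(2)])
    qed
    from reach_limit_bound[OF \<epsilon>0 \<epsilon> this]
    show "let df = chart_deriv c f x;
           dft = chart_deriv c ft x;
           dIMf = chart_deriv c IMf x;
           nrm = spectral_norm (G c x);
           C = (2 / \<tau> + 1 / (\<tau> - ereal \<epsilon>)) * ereal (nrm (\<lambda>v. dft v - df v) + nrm df)
       in ereal (nrm (\<lambda>v. dIMf v - df v))
            \<le> ereal (nrm (\<lambda>v. dft v - df v)) + C * ereal (norm (f x - ft x))"
      unfolding Let_def df dft by (simp add: nrm_def r_def)
  qed
qed

end
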